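(* Let $D$ be a skew field which is finite-dimensional over its center $C(D)$, $\sigma$ an automorphism of $D$ of finite order, and $R=D[X;\sigma]$. Let $D^\sigma$ be the skew subfield of $\sigma$-invariants, $K=C(D)\cap D^\sigma$, $\mu=\dim_K D$ (which is finite), and let $r$ be the rank of $R$ as a (free) module over its center. Let $\{d_1,\dots,d_s\}$ be a finite set of generators of $R$ as an algebra over its center. Let $f\in R$ be nonzero and $n=\deg f$. Then the number of basic operations needed to run Algorithm B (described in the context) on $f$, which computes a bound of $f$, belongs to $$\mathcal{O}\big(\sqrt{r}\,s\,n\,\mathrm{I}(\mu)+r\sqrt{r}\,n^3\,\mathrm{S}(\mu)+s\,r\,n^2(\mathrm{M}(\mu)+\mathrm{A}(\mu))\big).$$
   Context: $R=D[X;\sigma]$ is the skew polynomial ring: left $D$-basis $\{X^n:n\ge0\}$ and $Xa=\sigma(a)X$ for $a\in D$. A bound of $f$ is a polynomial $f^*$ with $Rf^*=f^*R=\operatorname{Ann}_R(R/Rf)$ (the largest twosided ideal contained in $Rf$). $\operatorname{lrem}(h,g)$ is the remainder $\rho$ in $h=qg+\rho$, $\deg\rho<\deg g$. Cost model. Basic operations are counted in $K$. $\mathrm{S}(\mu),\mathrm{M}(\mu),\mathrm{I}(\mu),\mathrm{A}(\mu)$ denote upper bounds for the number of basic operations in $K$ needed to perform in $D$, respectively, one addition, one multiplication, one inversion, and one evaluation $\sigma^i(a)$ of any power of $\sigma$ (a common bound for all $i$). Polynomial multiplication and left division with remainder in $R$ are the classical (schoolbook) ones. Algorithm A (annihilator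 of an element). Given nonzero $f,h\in R$, compute $v$ with $Rv=\operatorname{Ann}_R(h+Rf)=\{g: gh\in Rf\}$ by the extended Euclidean algorithm keeping only one cofactor: set $v_1\leftarrow1$, $v_0\leftarrow0$, $f_0\leftarrow f$, $f_1\leftarrow h$; perform the following step once, and then repeat it while $f_1\ne0$: write $f_0=cf_1+\rho$ with $\deg\rho<\deg f_1$, set $f_0\leftarrow f_1$, $f_1\leftarrow\rho$, $v\leftarrow v_0-cv_1$, $v_0\leftarrow v_1$, $v_1\leftarrow v$. Return $v_1$. The left least common multiple $[f,h]_\ell$ (generator of $Rf\cap Rh$) is computed as $vh$ with $v$ the output of Algorithm A. Algorithm B (computation of a bound). Set $g\leftarrow f$, $i\leftarrow1$. While $i\le s$: if $\operatorname{lrem}(gd_i,g)=0$ set $i\leftarrow i+1$; otherwise compute by Algorithm A a generator $g_{d_i}$ of $\operatorname{Ann}_R(d_i+Rg)$, set $g\leftarrow[g_{d_i},g]_\ell$ and $i\leftarrow1$. Return $g$.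
   Formalization: The estimate is for n ≥ 1 (at n = 0 the expression is 0 but the run is not free), under S(μ) ≤ M(μ) or s ≤ √r·n (else the additions in the tests are not covered), and the O-constant depends on a bound for the degrees of the generators d_i (no uniform one exists). *)

theory Defs
  imports
    Complex_Main
    "HOL-Computational_Algebra.Polynomial"
    "HOL-Library.While_Combinator"
    "HOL-Library.Monad_Syntax"
begin

text \<open>
  The multiplication is a parameter here because these notions are needed both for a skew field
  and for its skew polynomial ring; the latter lives on the type \<open>'a poly\<close>, whose own
  multiplication is not the skew one (and is not available for noncommutative coefficients).
\<close>

definition center_of :: "('b \<Rightarrow> 'b \<Rightarrow> 'b) \<Rightarrow> 'b set" where
  "center_of m = {z. \<forall>x. m z x = m x z}"

definition free_basis :: "('b::ab_group_add \<Rightarrow> 'b \<Rightarrow> 'b) \<Rightarrow> 'b set \<Rightarrow> 'b set \<Rightarrow> bool" where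
  "free_basis m Z B \<longleftrightarrow> finite B \<and>
     (\<forall>x. \<exists>!c. (\<forall>b. b \<in> B \<longrightarrow> c b \<in> Z) \<and> (\<forall>b. b \<notin> B \<longrightarrow> c b = 0) \<and> x = (\<Sum>b\<in>B. m (c b) b))"

definition free_rank :: "('b::ab_group_add \<Rightarrow> 'b \<Rightarrow> 'b) \<Rightarrow> 'b set \<Rightarrow> nat" where
  "free_rank m Z = card (SOME B. free_basis m Z B)"

text \<open>The subalgebras over the center \<open>Z\<close> are exactly the subrings that contain \<open>Z\<close>.\<close>

definition generates_over :: "('b::ab_group_add \<Rightarrow> 'b \<Rightarrow> 'b) \<Rightarrow> 'b set \<Rightarrow> 'b set \<Rightarrow> bool" where
  "generates_over m Z G \<longleftrightarrow>
     (\<lambda>T. \<forall>x\<in>T. \<forall>y\<in>T. x - y \<in> T \<and> m x y \<in> T) hull (Z \<union> G) = UNIV"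

definition ring_automorphism :: "('a::ring_1 \<Rightarrow> 'a) \<Rightarrow> bool" where
  "ring_automorphism \<sigma> \<longleftrightarrow> bij \<sigma> \<and> \<sigma> 1 = 1 \<and>
     (\<forall>x y. \<sigma> (x + y) = \<sigma> x + \<sigma> y) \<and> (\<forall>x y. \<sigma> (x * y) = \<sigma> x * \<sigma> y)"


text \<open>
  An element of \<open>D[X; \<sigma>]\<close> is represented by its sequence of left coefficients, as an
  element of \<open>'a poly\<close>; \<open>monom a n\<close> stands for \<open>a X\<^sup>n\<close>.  From \<open>X a = \<sigma>(a) X\<close> one gets
  \<open>(a X\<^sup>i) (b X\<^sup>j) = a \<sigma>\<^sup>i(b) X\<^sup>i\<^sup>+\<^sup>j\<close>.
\<close>

definition skew_mult :: "('a::division_ring \<Rightarrow> 'a) \<Rightarrow> 'a poly \<Rightarrow> 'a poly \<Rightarrow> 'a poly" where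
  "skew_mult \<sigma> p q =
     (\<Sum>i\<le>degree p. \<Sum>j\<le>degree q. monom (coeff p i * (\<sigma> ^^ i) (coeff q j)) (i + j))"

definition left_principal :: "('a::division_ring \<Rightarrow> 'a) \<Rightarrow> 'a poly \<Rightarrow> 'a poly set" where
  "left_principal \<sigma> f = {skew_mult \<sigma> h f | h. True}"

definition right_principal :: "('a::division_ring \<Rightarrow> 'a) \<Rightarrow> 'a poly \<Rightarrow> 'a poly set" where
  "right_principal \<sigma> f = {skew_mult \<sigma> f h | h. True}"

text \<open>\<open>a\<close> kills every coset \<open>h + Rf\<close>, that is, \<open>a h \<in> Rf\<close> for all \<open>h\<close>.\<close>

definition ann_quotient :: "('a::division_ring \<Rightarrow> 'a) \<Rightarrow> 'a poly \<Rightarrow> 'a poly set" where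
  "ann_quotient \<sigma> f = {a. \<forall>h. skew_mult \<sigma> a h \<in> left_principal \<sigma> f}"

definition is_bound :: "('a::division_ring \<Rightarrow> 'a) \<Rightarrow> 'a poly \<Rightarrow> 'a poly \<Rightarrow> bool" where
  "is_bound \<sigma> f g \<longleftrightarrow>
     left_principal \<sigma> g = ann_quotient \<sigma> f \<and> right_principal \<sigma> g = ann_quotient \<sigma> f"


text \<open>
  The four fields give the number of basic operations in \<open>K\<close> that are spent on adding two given
  elements of \<open>D\<close>, on multiplying them, on inverting an element, and on applying the \<open>i\<close>-th power
  of the automorphism to an element.
\<close>

record 'a op_cost =
  cost_add :: "'a \<Rightarrow> 'a \<Rightarrow> nat"
  cost_mul :: "'a \<Rightarrow> 'a \<Rightarrow> nat"
  cost_inv :: "'a \<Rightarrow> nat"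
  cost_aut :: "nat \<Rightarrow> 'a \<Rightarrow> nat"

text \<open>A computation is its result together with the number of basic operations performed.\<close>

type_synonym 'x counted = "'x \<times> nat"

definition ret :: "'x \<Rightarrow> 'x counted" where
  "ret x = (x, 0)"

definition counted_bind :: "'x counted \<Rightarrow> ('x \<Rightarrow> 'y counted) \<Rightarrow> 'y counted" where
  "counted_bind a k = (case a of (x, c) \<Rightarrow> case k x of (y, d) \<Rightarrow> (y, c + d))"

adhoc_overloading Monad_Syntax.bind \<rightleftharpoons> counted_bind

primrec for_each :: "'b list \<Rightarrow> ('b \<Rightarrow> 'x \<Rightarrow> 'x counted) \<Rightarrow> 'x \<Rightarrow> 'x counted" where
  "for_each [] body x = ret x"
| "for_each (b # bs) body x = do { y \<leftarrow> body b x; for_each bs body y }"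

definition counted_while :: "('x \<Rightarrow> bool) \<Rightarrow> ('x \<Rightarrow> 'x counted) \<Rightarrow> 'x \<Rightarrow> 'x counted option" where
  "counted_while P body x = while_option (\<lambda>a. P (fst a)) (\<lambda>a. do { y \<leftarrow> a; body y }) (ret x)"

context
  fixes \<sigma> :: "'a::division_ring \<Rightarrow> 'a" and cm :: "'a op_cost"
begin

text \<open>
  Only operations of \<open>D\<close> are charged; tests against zero, comparison of degrees and storing of
  coefficients are free.  A subtraction is charged as an addition.  Adding \<open>a X\<^sup>k\<close> to \<open>p\<close> changes
  the coefficient of \<open>X\<^sup>k\<close> only, by one addition in \<open>D\<close>.
\<close>

definition mul_op :: "'a \<Rightarrow> 'a \<Rightarrow> 'a counted" where
  "mul_op a b = (a * b, cost_mul cm a b)"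

definition inv_op :: "'a \<Rightarrow> 'a counted" where
  "inv_op a = (inverse a, cost_inv cm a)"

definition aut_op :: "nat \<Rightarrow> 'a \<Rightarrow> 'a counted" where
  "aut_op i a = ((\<sigma> ^^ i) a, cost_aut cm i a)"

definition add_term :: "'a poly \<Rightarrow> nat \<Rightarrow> 'a \<Rightarrow> 'a poly counted" where
  "add_term p k a = (p + monom a k, cost_add cm (coeff p k) a)"

definition sub_term :: "'a poly \<Rightarrow> nat \<Rightarrow> 'a \<Rightarrow> 'a poly counted" where
  "sub_term p k a = (p - monom a k, cost_add cm (coeff p k) (- a))"


text \<open>The list \<open>coeffs p\<close> is empty for \<open>p = 0\<close> and has length \<open>degree p + 1\<close> otherwise.\<close>

definition poly_sub :: "'a poly \<Rightarrow> 'a poly \<Rightarrow> 'a poly counted" where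
  "poly_sub p q = for_each [0..<length (coeffs q)] (\<lambda>k acc. sub_term acc k (coeff q k)) p"

definition poly_mul :: "'a poly \<Rightarrow> 'a poly \<Rightarrow> 'a poly counted" where
  "poly_mul p q =
     for_each [0..<length (coeffs p)] (\<lambda>i.
       for_each [0..<length (coeffs q)] (\<lambda>j acc. do {
         b \<leftarrow> aut_op i (coeff q j);
         c \<leftarrow> mul_op (coeff p i) b;
         add_term acc (i + j) c
       })) 0"

text \<open>
  Quotient \<open>q\<close> and remainder \<open>\<rho>\<close> in \<open>h = q g + \<rho>\<close>, for \<open>g\<close> nonzero.  With \<open>m\<close> the degree of \<open>g\<close>,
  \<open>u\<close> the inverse of its leading coefficient, and \<open>a\<close> the coefficient of \<open>X\<^sup>m\<^sup>+\<^sup>k\<close> in the current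
  remainder, the coefficient of \<open>X\<^sup>k\<close> in the quotient is \<open>c = a \<sigma>\<^sup>k(u)\<close>, and \<open>c X\<^sup>k g\<close> is
  subtracted.  The summand \<open>monom c k\<close> only stores \<open>c\<close>, so it is not charged.
\<close>

definition left_div_step ::
  "'a poly \<Rightarrow> 'a \<Rightarrow> nat \<Rightarrow> 'a poly \<times> 'a poly \<Rightarrow> ('a poly \<times> 'a poly) counted" where
  "left_div_step g u k = (\<lambda>(q, \<rho>). do {
     u' \<leftarrow> aut_op k u;
     c \<leftarrow> mul_op (coeff \<rho> (degree g + k)) u';
     \<rho>' \<leftarrow> for_each [0..<length (coeffs g)] (\<lambda>j acc. do {
       b \<leftarrow> aut_op k (coeff g j);
       y \<leftarrow> mul_op c b;
       sub_term acc (k + j) y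
     }) \<rho>;
     ret (q + monom c k, \<rho>')
   })"

definition left_div :: "'a poly \<Rightarrow> 'a poly \<Rightarrow> ('a poly \<times> 'a poly) counted" where
  "left_div h g =
     (if h = 0 \<or> degree h < degree g then ret (0, h)
      else do {
        u \<leftarrow> inv_op (lead_coeff g);
        for_each (rev [0..<Suc (degree h - degree g)]) (left_div_step g u) (0, h)
      })"


text \<open>The state is \<open>(f\<^sub>0, f\<^sub>1, v\<^sub>0, v\<^sub>1)\<close>.\<close>

definition algorithm_A_step ::
  "'a poly \<times> 'a poly \<times> 'a poly \<times> 'a poly \<Rightarrow> ('a poly \<times> 'a poly \<times> 'a poly \<times> 'a poly) counted" where
  "algorithm_A_step = (\<lambda>(f0, f1, v0, v1). do {
     (c, \<rho>) \<leftarrow> left_div f0 f1;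
     w \<leftarrow> poly_mul c v1;
     v \<leftarrow> poly_sub v0 w;
     ret (f1, \<rho>, v1, v)
   })"

text \<open>
  The step is performed once before the loop.  The degree of \<open>f\<^sub>1\<close> decreases, so for nonzero \<open>h\<close>
  the loop ends and \<open>the\<close> is applied to \<open>Some\<close> value.
\<close>

definition algorithm_A :: "'a poly \<Rightarrow> 'a poly \<Rightarrow> 'a poly counted" where
  "algorithm_A f h = do {
     st \<leftarrow> algorithm_A_step (f, h, 0, [:1:]);
     (f0, f1, v0, v1) \<leftarrow> the (counted_while (\<lambda>(f0, f1, v0, v1). f1 \<noteq> 0) algorithm_A_step st);
     ret v1
   }"

definition left_lcm :: "'a poly \<Rightarrow> 'a poly \<Rightarrow> 'a poly counted" where
  "left_lcm f h = do { v \<leftarrow> algorithm_A f h; poly_mul v h }"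

text \<open>
  The state is \<open>(g, i)\<close>; the index \<open>i\<close> starts at 1, whereas list positions start at 0.  The result
  is \<open>None\<close> if the loop does not end.
\<close>

definition algorithm_B_step :: "'a poly list \<Rightarrow> 'a poly \<times> nat \<Rightarrow> ('a poly \<times> nat) counted" where
  "algorithm_B_step ds = (\<lambda>(g, i). do {
     let d = ds ! (i - 1);
     p \<leftarrow> poly_mul g d;
     (q, \<rho>) \<leftarrow> left_div p g;
     if \<rho> = 0 then ret (g, i + 1)
     else do {
       gd \<leftarrow> algorithm_A g d;
       g' \<leftarrow> left_lcm gd g;
       ret (g', 1)
     }
   })"

definition algorithm_B :: "'a poly list \<Rightarrow> 'a poly \<Rightarrow> 'a poly counted option" where
  "algorithm_B ds f =
     map_option (\<lambda>((g, i), t). (g, t))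
       (counted_while (\<lambda>(g, i). i \<le> length ds) (algorithm_B_step ds) (f, 1))"

end


text \<open>
  The number of operations in one product \<open>g d\<^sub>i\<close> grows with the degree of \<open>d\<^sub>i\<close>, so the constant
  depends on a bound \<open>\<delta>\<close> for the degrees of the generators, but on nothing else.  It is given explicitly
  because in a statement of the form \<open>\<exists>C. \<dots>\<close> about a type \<open>'a\<close> of class \<open>division_ring\<close>, the
  number \<open>C\<close> would be allowed to depend on that type, that is, on the skew field.
\<close>

definition implied_constant :: "nat \<Rightarrow> real" where
  "implied_constant \<delta> = 10000 * (real \<delta> + 1) ^ 4"

end

theory Submission
  imports Defs
begin

text \<open>
  The ideal generated by the bound \<open>F\<close> stays inside every left ideal \<open>Rg\<close> visited by Algorithm B, so
  \<open>deg g \<le> deg F\<close> throughout, and \<open>deg F \<le> \<surd>r n\<close>. The latter is proved without reduced norms: degrees of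
  bounds are subadditive along factorizations, and for \<open>Rf\<close> maximal, a largest family of elements of
  the simple module \<open>R/Rf\<close> with a dual family in \<open>R\<close> has some size \<open>t\<close>; the bound has degree at most
  \<open>t n\<close>, and the resulting \<open>t\<^sup>2\<close> matrix units are independent over a residue domain of the center, over
  which \<open>R\<close> is spanned by \<open>r\<close> elements, so \<open>t\<^sup>2 \<le> r\<close>.

  Every update of \<open>g\<close> raises its degree by some \<open>e \<ge> 1\<close>. Since \<open>d\<^sub>i\<close> has degree at most \<open>\<delta>\<close>, the first
  Euclidean algorithm of an update makes \<open>O(\<delta>)\<close> divisions, and the quotients of the second one have
  total degree \<open>e + O(\<delta>)\<close>; hence an update costs \<open>O(e deg g)\<close> operations in \<open>D\<close> and \<open>O(e)\<close> inversions,
  and the \<open>e\<close> sum up to at most \<open>\<surd>r n\<close>. Between two updates there are at most \<open>s\<close> divisibility tests, each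
  with one inversion and \<open>O(deg g)\<close> further operations.
\<close>

section \<open>Skew polynomial rings\<close>

text \<open>Write N for sqrt r * n. There are up to about s N tests, each with O(N) additions, so
  their additions can reach the order s N^2 S, a term missing from the claimed sum. It is absorbed
  by s N^2 M if S <= M and by N^3 S if s <= N, which explains the disjunction in the premise of the
  cost estimate. The premise n >= 1 has a similar origin: for a nonzero constant f the sum vanishes,
  but the generators are still tested. The number r is read off a basis selected by choice, so it
  means something only once R is known to be free over its center. That takes a section of its own:
  D is finite-dimensional over K by an Artin-type argument, and the center of R is graded by degree,
  which produces an explicit basis.\<close>

lemma poly_additive_induct [case_names monom add]:
  fixes p :: "'a::comm_monoid_add poly"
  assumes "\<And>a n. P (monom a n)" and "\<And>p q. P p \<Longrightarrow> P q \<Longrightarrow> P (p + q)"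
  shows "P p"
proof -
  have "P (\<Sum>i\<le>m. monom (coeff p i) i)" for m
    by (induction m) (simp_all add: assms)
  then show ?thesis
    by (metis poly_as_sum_of_monoms)
qed

locale skew_poly =
  fixes \<sigma> :: "'a::division_ring \<Rightarrow> 'a"
  assumes aut: "ring_automorphism \<sigma>"
begin

abbreviation mult :: "'a poly \<Rightarrow> 'a poly \<Rightarrow> 'a poly" (infixl "\<odot>" 70)
  where "p \<odot> q \<equiv> skew_mult \<sigma> p q"

abbreviation LI :: "'a poly \<Rightarrow> 'a poly set"
  where "LI f \<equiv> left_principal \<sigma> f"

lemma aut_add [simp]: "(\<sigma> ^^ i) (x + y) = (\<sigma> ^^ i) x + (\<sigma> ^^ i) y"
  and aut_mult [simp]: "(\<sigma> ^^ i) (x * y) = (\<sigma> ^^ i) x * (\<sigma> ^^ i) y"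
  and aut_one [simp]: "(\<sigma> ^^ i) 1 = 1"
  and bij_aut: "bij (\<sigma> ^^ i)"
  using aut unfolding ring_automorphism_def
  by (induction i) (auto intro!: bij_comp)

lemma aut_zero [simp]: "(\<sigma> ^^ i) 0 = 0"
  using aut_add[of i 0 0] by simp

lemma aut_minus [simp]: "(\<sigma> ^^ i) (- x) = - (\<sigma> ^^ i) x"
  using aut_add[of i x "- x"] by (simp add: eq_neg_iff_add_eq_0 add.commute)

lemma aut_diff [simp]: "(\<sigma> ^^ i) (x - y) = (\<sigma> ^^ i) x - (\<sigma> ^^ i) y"
  using aut_add[of i x "- y"] by simp

lemma aut_eq_0_iff [simp]: "(\<sigma> ^^ i) x = 0 \<longleftrightarrow> x = 0"
  using bij_aut[of i] aut_zero[of i] by (metis bij_pointE)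

lemma aut_sum: "(\<sigma> ^^ i) (sum g A) = (\<Sum>a\<in>A. (\<sigma> ^^ i) (g a))"
  by (induction A rule: infinite_finite_induct) auto

text \<open>No degree of \<open>p\<close> or \<open>q\<close> occurs on the right, so additivity in
  each factor can be read off coefficientwise; the defining double sum, whose ranges depend on the
  degrees, hides it.\<close>

lemma coeff_skew_mult:
  "coeff (p \<odot> q) n = (\<Sum>i\<le>n. coeff p i * (\<sigma> ^^ i) (coeff q (n - i)))"
proof -
  have inner: "(\<Sum>j\<le>degree q. coeff (monom (coeff p i * (\<sigma> ^^ i) (coeff q j)) (i + j)) n)
      = (if i \<le> n then coeff p i * (\<sigma> ^^ i) (coeff q (n - i)) else 0)" for i
  proof (cases "i \<le> n \<and> n - i \<le> degree q")
    case True
    have "(\<Sum>j\<le>degree q. coeff (monom (coeff p i * (\<sigma> ^^ i) (coeff q j)) (i + j)) n)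
      = (\<Sum>j\<le>degree q. if j = n - i then coeff p i * (\<sigma> ^^ i) (coeff q (n - i)) else 0)"
      using True by (intro sum.cong) auto
    then show ?thesis using True by simp
  next
    case False
    then show ?thesis
      by (auto intro!: sum.neutral simp: coeff_eq_0)
  qed
  have "coeff (p \<odot> q) n
      = (\<Sum>i\<le>degree p. if i \<le> n then coeff p i * (\<sigma> ^^ i) (coeff q (n - i)) else 0)"
    unfolding skew_mult_def coeff_sum inner ..
  also have "\<dots> = (\<Sum>i\<in>{..degree p} \<inter> {..n}. coeff p i * (\<sigma> ^^ i) (coeff q (n - i)))"
    by (simp add: sum.If_cases atMost_def)
  also have "\<dots> = (\<Sum>i\<le>n. coeff p i * (\<sigma> ^^ i) (coeff q (n - i)))"
    by (intro sum.mono_neutral_left) (auto simp: coeff_eq_0)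
  finally show ?thesis .
qed

lemma mult_add_left [simp]: "(p + q) \<odot> h = p \<odot> h + q \<odot> h"
  and mult_add_right [simp]: "h \<odot> (p + q) = h \<odot> p + h \<odot> q"
  by (simp_all add: poly_eq_iff coeff_skew_mult algebra_simps sum.distrib)

lemma mult_zero_left [simp]: "0 \<odot> p = 0"
  and mult_zero_right [simp]: "p \<odot> 0 = 0"
  by (simp_all add: poly_eq_iff coeff_skew_mult)

lemma mult_minus_left [simp]: "(- p) \<odot> h = - (p \<odot> h)"
  and mult_minus_right [simp]: "h \<odot> (- p) = - (h \<odot> p)"
  by (simp_all add: poly_eq_iff coeff_skew_mult sum_negf)

lemma mult_diff_left [simp]: "(p - q) \<odot> h = p \<odot> h - q \<odot> h"
  and mult_diff_right [simp]: "h \<odot> (p - q) = h \<odot> p - h \<odot> q"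
  using mult_add_left[of p "- q" h] mult_add_right[of h p "- q"] by simp_all

lemma mult_sum_left: "sum g A \<odot> h = (\<Sum>a\<in>A. g a \<odot> h)"
  by (induction A rule: infinite_finite_induct) auto

lemma mult_sum_right: "h \<odot> sum g A = (\<Sum>a\<in>A. h \<odot> g a)"
  by (induction A rule: infinite_finite_induct) auto

lemma coeff_monom_mult:
  "coeff (monom a i \<odot> q) n = (if i \<le> n then a * (\<sigma> ^^ i) (coeff q (n - i)) else 0)"
proof -
  have "coeff (monom a i \<odot> q) n = (\<Sum>k\<le>n. if k = i then a * (\<sigma> ^^ i) (coeff q (n - i)) else 0)"
    unfolding coeff_skew_mult by (intro sum.cong) auto
  then show ?thesis by simp
qed

lemma coeff_mult_monom:
  "coeff (p \<odot> monom b i) n = (if i \<le> n then coeff p (n - i) * (\<sigma> ^^ (n - i)) b else 0)"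
proof (cases "i \<le> n")
  case True
  have "coeff (p \<odot> monom b i) n
      = (\<Sum>k\<le>n. if k = n - i then coeff p (n - i) * (\<sigma> ^^ (n - i)) b else 0)"
    unfolding coeff_skew_mult using True by (intro sum.cong) auto
  then show ?thesis using True by simp
next
  case False
  then show ?thesis by (auto simp: coeff_skew_mult intro!: sum.neutral)
qed

lemma monom_mult_monom: "monom a i \<odot> monom b j = monom (a * (\<sigma> ^^ i) b) (i + j)"
  by (auto simp: poly_eq_iff coeff_monom_mult)

text \<open>Both sides are additive in each of the three factors, so monomials suffice; there it is
  the rule that \<sigma>^(i+j) is \<sigma>^i after \<sigma>^j.\<close>

lemma mult_assoc: "p \<odot> q \<odot> h = p \<odot> (q \<odot> h)"
proof (induction p rule: poly_additive_induct)
  case (monom a i)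
  show ?case
  proof (induction q rule: poly_additive_induct)
    case (monom b j)
    show ?case
    proof (induction h rule: poly_additive_induct)
      case (monom c k)
      show ?case
        by (simp add: monom_mult_monom mult.assoc add.assoc funpow_add)
    qed simp
  qed simp
qed simp

lemma one_mult [simp]: "[:1:] \<odot> p = p"
  using coeff_monom_mult[of 1 0 p] by (simp add: poly_eq_iff monom_0)

lemma mult_one [simp]: "p \<odot> [:1:] = p"
  using coeff_mult_monom[of p 1 0] by (simp add: poly_eq_iff monom_0)

text \<open>The twist of the second leading coefficient is by an injective map, so this coefficient
  is nonzero for nonzero factors; degrees therefore add and R has no zero divisors.\<close>

lemma coeff_mult_degree_sum:
  "coeff (p \<odot> q) (degree p + degree q) = lead_coeff p * (\<sigma> ^^ degree p) (lead_coeff q)"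
proof -
  have "coeff (p \<odot> q) (degree p + degree q) = (\<Sum>i\<le>degree p + degree q.
      if i = degree p then lead_coeff p * (\<sigma> ^^ degree p) (lead_coeff q) else 0)"
    unfolding coeff_skew_mult
  proof (intro sum.cong refl)
    fix i
    show "coeff p i * (\<sigma> ^^ i) (coeff q (degree p + degree q - i))
      = (if i = degree p then lead_coeff p * (\<sigma> ^^ degree p) (lead_coeff q) else 0)"
      by (cases i "degree p" rule: linorder_cases) (auto simp: coeff_eq_0)
  qed
  then show ?thesis by simp
qed

lemma degree_mult_le: "degree (p \<odot> q) \<le> degree p + degree q"
proof (intro degree_le allI impI)
  fix n assume n: "degree p + degree q < n"
  show "coeff (p \<odot> q) n = 0"
    unfolding coeff_skew_mult
  proof (intro sum.neutral ballI)
    fix i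
    show "coeff p i * (\<sigma> ^^ i) (coeff q (n - i)) = 0"
      using n by (cases "i \<le> degree p") (auto simp: coeff_eq_0)
  qed
qed

lemma mult_eq_0_iff [simp]: "p \<odot> q = 0 \<longleftrightarrow> p = 0 \<or> q = 0"
proof (cases "p = 0 \<or> q = 0")
  case False
  then have "coeff (p \<odot> q) (degree p + degree q) \<noteq> 0"
    unfolding coeff_mult_degree_sum by simp
  then show ?thesis using False by auto
qed auto

lemma degree_mult: "p \<noteq> 0 \<Longrightarrow> q \<noteq> 0 \<Longrightarrow> degree (p \<odot> q) = degree p + degree q"
  using degree_mult_le[of p q] coeff_mult_degree_sum[of p q]
  by (intro antisym le_degree) auto

lemma left_principalI: "h \<odot> f \<in> LI f"
  by (auto simp: left_principal_def)

lemma left_principal_self: "f \<in> LI f"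
  using left_principalI[of "[:1:]" f] by simp

lemma left_principal_zero: "0 \<in> LI f"
  using left_principalI[of 0 f] by simp

lemma left_principal_add: "p \<in> LI f \<Longrightarrow> q \<in> LI f \<Longrightarrow> p + q \<in> LI f"
  and left_principal_diff: "p \<in> LI f \<Longrightarrow> q \<in> LI f \<Longrightarrow> p - q \<in> LI f"
  unfolding left_principal_def by (auto simp flip: mult_add_left mult_diff_left)

lemma left_principal_mult: "p \<in> LI f \<Longrightarrow> a \<odot> p \<in> LI f"
  unfolding left_principal_def by (auto simp flip: mult_assoc)

lemma left_principal_sum: "(\<And>a. a \<in> A \<Longrightarrow> g a \<in> LI f) \<Longrightarrow> sum g A \<in> LI f"
  by (induction A rule: infinite_finite_induct) (auto intro: left_principal_zero left_principal_add)

lemma left_principal_subset: "g \<in> LI f \<Longrightarrow> LI g \<subseteq> LI f"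
  using left_principal_mult[of g f] by (auto simp: left_principal_def)

lemma degree_left_principal: "h \<in> LI g \<Longrightarrow> h \<noteq> 0 \<Longrightarrow> degree g \<le> degree h"
  by (auto simp: left_principal_def degree_mult)

end

section \<open>Correctness and cost of the algorithms\<close>

lemma fst_ret [simp]: "fst (ret x) = x" and snd_ret [simp]: "snd (ret x) = 0"
  by (simp_all add: ret_def)

lemma fst_counted_bind [simp]: "fst (counted_bind a k) = fst (k (fst a))"
  and snd_counted_bind [simp]: "snd (counted_bind a k) = snd a + snd (k (fst a))"
  by (simp_all add: counted_bind_def split: prod.splits)

lemma fst_for_each: "fst (for_each bs body x) = fold (\<lambda>b y. fst (body b y)) bs x"
  by (induction bs arbitrary: x) simp_all

lemma snd_for_each_le:
  assumes "\<And>b y. b \<in> set bs \<Longrightarrow> real (snd (body b y)) \<le> c"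
  shows "real (snd (for_each bs body x)) \<le> real (length bs) * c"
  using assms
proof (induction bs arbitrary: x)
  case (Cons b bs)
  have "real (snd (body b x)) \<le> c" by (simp add: Cons.prems)
  moreover have "real (snd (for_each bs body (fst (body b x)))) \<le> real (length bs) * c"
    using Cons by auto
  ultimately show ?case by (simp add: algebra_simps)
qed simp

lemma fold_upt_add:
  fixes g :: "nat \<Rightarrow> 'b::ab_group_add"
  shows "fold (\<lambda>k y. y + g k) [0..<n] x = x + (\<Sum>k<n. g k)"
  by (induction n) (simp_all add: algebra_simps)

lemma fold_upt_diff:
  fixes g :: "nat \<Rightarrow> 'b::ab_group_add"
  shows "fold (\<lambda>k y. y - g k) [0..<n] x = x - (\<Sum>k<n. g k)"
  by (induction n) (simp_all add: algebra_simps)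

text \<open>The two ranges differ only for \<open>p = 0\<close>, where the loops over
  \<open>coeffs p\<close> are empty while \<open>degree p\<close> still allows the index 0.\<close>

lemma sum_length_coeffs:
  assumes "\<And>k. coeff p k = 0 \<Longrightarrow> F k = 0"
  shows "(\<Sum>k<length (coeffs p). F k) = (\<Sum>k\<le>degree p. F k)"
  using assms by (cases "p = 0") (auto simp: length_coeffs_degree lessThan_Suc_atMost)

text \<open>\<open>Inv\<close> sees the running cost next to the state, so one invariant yields
  correctness and cost at once. The decreasing \<open>m\<close> gives \<open>Some\<close>.\<close>

lemma counted_while_rule:
  fixes m :: "'x \<Rightarrow> nat"
  assumes step: "\<And>x t. Inv x t \<Longrightarrow> P x \<Longrightarrow>
      Inv (fst (body x)) (t + snd (body x)) \<and> m (fst (body x)) < m x"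
    and init: "Inv x 0"
  shows "\<exists>y t. counted_while P body x = Some (y, t) \<and> Inv y t \<and> \<not> P y"
proof -
  let ?c = "\<lambda>a. counted_bind a body"
  have "\<exists>a. while_option (\<lambda>a. P (fst a)) ?c (ret x) = Some a"
    by (rule measure_while_option_Some[where P = "\<lambda>a. Inv (fst a) (snd a)" and f = "\<lambda>a. m (fst a)"])
      (use step init in auto)
  then obtain a where a: "while_option (\<lambda>a. P (fst a)) ?c (ret x) = Some a" ..
  have "Inv (fst a) (snd a)"
    by (rule while_option_rule[OF _ a, where P = "\<lambda>a. Inv (fst a) (snd a)"])
      (use step init in auto)
  moreover have "\<not> P (fst a)"
    using while_option_stop[OF a] .
  ultimately show ?thesis
    using a by (cases a) (auto simp: counted_while_def)
qed

locale skew_poly_cost = skew_poly \<sigma> for \<sigma> :: "'a::division_ring \<Rightarrow> 'a" +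
  fixes cm :: "'a op_cost" and S M I A :: real
  assumes add_bound: "\<And>a b. real (cost_add cm a b) \<le> S"
    and mul_bound: "\<And>a b. real (cost_mul cm a b) \<le> M"
    and inv_bound: "\<And>a. a \<noteq> 0 \<Longrightarrow> real (cost_inv cm a) \<le> I"
    and aut_bound: "\<And>i a. real (cost_aut cm i a) \<le> A"
begin

text \<open>Price of one inner iteration of the schoolbook routines: at most one power of \<sigma>,
  one product and one addition.\<close>

definition \<tau> :: real where "\<tau> = S + M + A"

lemma bounds_nonneg: "0 \<le> S" "0 \<le> M" "0 \<le> I" "0 \<le> A" "0 \<le> \<tau>"
proof -
  show *: "0 \<le> S" "0 \<le> M" "0 \<le> I" "0 \<le> A"
    using add_bound[of 0 0] mul_bound[of 0 0] inv_bound[of 1] aut_bound[of 0 0]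
    by (auto intro: order_trans[OF of_nat_0_le_iff])
  then show "0 \<le> \<tau>" by (simp add: \<tau>_def)
qed

lemmas op_defs = mul_op_def inv_op_def aut_op_def add_term_def sub_term_def

lemma fst_poly_sub: "fst (poly_sub cm p q) = p - q"
proof -
  have "(\<Sum>k<length (coeffs q). monom (coeff q k) k) = q"
    by (subst sum_length_coeffs) (auto simp: poly_as_sum_of_monoms)
  then show ?thesis
    by (simp add: poly_sub_def fst_for_each op_defs fold_upt_diff)
qed

lemma snd_poly_sub: "real (snd (poly_sub cm p q)) \<le> real (length (coeffs q)) * \<tau>"
proof -
  have "S \<le> \<tau>" using bounds_nonneg by (simp add: \<tau>_def)
  have "real (snd (poly_sub cm p q)) \<le> real (length [0..<length (coeffs q)]) * \<tau>"
    unfolding poly_sub_def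
    by (intro snd_for_each_le) (auto simp: op_defs intro: order_trans[OF add_bound \<open>S \<le> \<tau>\<close>])
  then show ?thesis by simp
qed

lemma fst_poly_mul: "fst (poly_mul \<sigma> cm p q) = p \<odot> q"
proof -
  let ?t = "\<lambda>i j. monom (coeff p i * (\<sigma> ^^ i) (coeff q j)) (i + j)"
  have "fst (poly_mul \<sigma> cm p q)
      = (\<Sum>i<length (coeffs p). \<Sum>j<length (coeffs q). ?t i j)"
    by (simp add: poly_mul_def fst_for_each op_defs fold_upt_add)
  also have "\<dots> = (\<Sum>i<length (coeffs p). \<Sum>j\<le>degree q. ?t i j)"
    by (intro sum.cong sum_length_coeffs refl) auto
  also have "\<dots> = p \<odot> q"
    unfolding skew_mult_def by (intro sum_length_coeffs) auto
  finally show ?thesis .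
qed

lemma term_cost:
  "real (cost_aut cm i a) + (real (cost_mul cm b c) + real (cost_add cm d e)) \<le> \<tau>"
  using add_bound mul_bound aut_bound unfolding \<tau>_def
  by (smt (verit))

lemma snd_poly_mul:
  "real (snd (poly_mul \<sigma> cm p q)) \<le> real (length (coeffs p)) * (real (length (coeffs q)) * \<tau>)"
proof -
  have "real (snd (poly_mul \<sigma> cm p q))
      \<le> real (length [0..<length (coeffs p)]) * (real (length [0..<length (coeffs q)]) * \<tau>)"
    unfolding poly_mul_def
    by (intro snd_for_each_le) (simp add: op_defs term_cost)
  then show ?thesis by simp
qed

lemma left_div_step:
  assumes "c = coeff \<rho> (degree g + k) * (\<sigma> ^^ k) u"
  shows "fst (left_div_step \<sigma> cm g u k (q, \<rho>)) = (q + monom c k, \<rho> - monom c k \<odot> g)"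
    and "real (snd (left_div_step \<sigma> cm g u k (q, \<rho>))) \<le> \<tau> + real (length (coeffs g)) * \<tau>"
proof -
  have "(\<Sum>j<length (coeffs g). monom (c * (\<sigma> ^^ k) (coeff g j)) (k + j))
      = (\<Sum>j\<le>degree g. monom (c * (\<sigma> ^^ k) (coeff g j)) (k + j))"
    by (intro sum_length_coeffs) auto
  also have "\<dots> = monom c k \<odot> (\<Sum>j\<le>degree g. monom (coeff g j) j)"
    by (simp add: mult_sum_right monom_mult_monom)
  finally have "(\<Sum>j<length (coeffs g). monom (c * (\<sigma> ^^ k) (coeff g j)) (k + j)) = monom c k \<odot> g"
    by (simp add: poly_as_sum_of_monoms)
  then show "fst (left_div_step \<sigma> cm g u k (q, \<rho>)) = (q + monom c k, \<rho> - monom c k \<odot> g)"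
    by (simp add: left_div_step_def fst_for_each op_defs fold_upt_diff assms)
next
  let ?loop = "for_each [0..<length (coeffs g)] (\<lambda>j acc. do {
       b \<leftarrow> aut_op \<sigma> cm k (coeff g j);
       y \<leftarrow> mul_op cm c b;
       sub_term cm acc (k + j) y
     }) \<rho>"
  have "real (snd ?loop) \<le> real (length [0..<length (coeffs g)]) * \<tau>"
    by (intro snd_for_each_le) (simp add: op_defs term_cost)
  moreover have "real (cost_aut cm k u) + real (cost_mul cm (coeff \<rho> (degree g + k)) ((\<sigma> ^^ k) u)) \<le> \<tau>"
    using term_cost[of k u "coeff \<rho> (degree g + k)" "(\<sigma> ^^ k) u" 0 0] by simp
  moreover have "snd (left_div_step \<sigma> cm g u k (q, \<rho>)) = cost_aut cm k u +
      (cost_mul cm (coeff \<rho> (degree g + k)) ((\<sigma> ^^ k) u) + snd ?loop)"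
    by (simp add: left_div_step_def assms op_defs)
  ultimately show "real (snd (left_div_step \<sigma> cm g u k (q, \<rho>))) \<le> \<tau> + real (length (coeffs g)) * \<tau>"
    by simp
qed

text \<open>The indices run downwards, so \<open>k\<close> counts the positions still to be cleared.
  Vanishing coefficients are used instead of a degree bound because for constant \<open>g\<close>
  the remainder is 0 and has no smaller degree.\<close>

lemma left_div_loop:
  assumes "g \<noteq> 0" and "\<forall>i\<ge>degree g + k. coeff \<rho> i = 0"
    and "for_each (rev [0..<k]) (left_div_step \<sigma> cm g (inverse (lead_coeff g))) (q, \<rho>) = ((q', \<rho>'), t)"
  shows "q' \<odot> g + \<rho>' = q \<odot> g + \<rho> \<and> (\<forall>i\<ge>degree g. coeff \<rho>' i = 0)"
  using assms(2,3)
proof (induction k arbitrary: q \<rho> t)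
  case 0
  then show ?case by (simp add: ret_def)
next
  case (Suc k)
  define u where "u = inverse (lead_coeff g)"
  define c where "c = coeff \<rho> (degree g + k) * (\<sigma> ^^ k) u"
  define \<rho>1 where "\<rho>1 = \<rho> - monom c k \<odot> g"
  note step = left_div_step(1)[OF c_def, of q]
  have "fst (for_each (rev [0..<k]) (left_div_step \<sigma> cm g u) (q + monom c k, \<rho>1)) = (q', \<rho>')"
    using arg_cong[OF Suc.prems(2), of fst] step by (simp add: u_def \<rho>1_def)
  then obtain t' where t': "for_each (rev [0..<k]) (left_div_step \<sigma> cm g u) (q + monom c k, \<rho>1) = ((q', \<rho>'), t')"
    by (metis prod.collapse)
  have "coeff \<rho>1 i = 0" if "i \<ge> degree g + k" for i
  proof (cases "i = degree g + k")
    case True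
    \<comment> \<open>Applying \<sigma>^k to u * lead_coeff g = 1 shows that \<open>c\<close>
      cancels the coefficient at \<open>degree g + k\<close>.\<close>
    have "(\<sigma> ^^ k) u * (\<sigma> ^^ k) (lead_coeff g) = 1"
      using assms(1) by (simp flip: aut_mult add: u_def)
    then show ?thesis
      using True by (simp add: \<rho>1_def coeff_monom_mult c_def mult.assoc)
  next
    case False
    then have "i \<ge> degree g + Suc k" using that by simp
    then show ?thesis
      using Suc.prems(1) by (simp add: \<rho>1_def coeff_monom_mult coeff_eq_0)
  qed
  then have "q' \<odot> g + \<rho>' = (q + monom c k) \<odot> g + \<rho>1 \<and> (\<forall>i\<ge>degree g. coeff \<rho>' i = 0)"
    using Suc.IH[of \<rho>1 "q + monom c k" t'] t' by (simp add: u_def)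
  then show ?case by (simp add: \<rho>1_def algebra_simps)
qed

lemma left_div_correct:
  assumes "g \<noteq> 0" and "fst (left_div \<sigma> cm h g) = (q, \<rho>)"
  shows "h = q \<odot> g + \<rho>" and "\<rho> = 0 \<or> degree \<rho> < degree g"
proof -
  have "h = q \<odot> g + \<rho> \<and> (\<rho> = 0 \<or> degree \<rho> < degree g)"
  proof (cases "h = 0 \<or> degree h < degree g")
    case True
    then show ?thesis using assms by (auto simp: left_div_def)
  next
    case False
    let ?k = "Suc (degree h - degree g)"
    obtain t where "for_each (rev [0..<?k]) (left_div_step \<sigma> cm g (inverse (lead_coeff g))) (0, h) = ((q, \<rho>), t)"
      using assms(2) False by (cases "for_each (rev [0..<?k]) (left_div_step \<sigma> cm g (inverse (lead_coeff g))) (0, h)")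
        (auto simp: left_div_def inv_op_def simp del: upt_Suc)
    moreover have "\<forall>i\<ge>degree g + ?k. coeff h i = 0"
      using False by (auto intro: coeff_eq_0)
    ultimately have "q \<odot> g + \<rho> = 0 \<odot> g + h \<and> (\<forall>i\<ge>degree g. coeff \<rho> i = 0)"
      using left_div_loop[OF assms(1)] by blast
    then show ?thesis
      by (metis add.left_neutral leading_coeff_0_iff linorder_not_less mult_zero_left)
  qed
  then show "h = q \<odot> g + \<rho>" and "\<rho> = 0 \<or> degree \<rho> < degree g" by auto
qed

lemma left_div_trivial: "h = 0 \<or> degree h < degree g \<Longrightarrow> left_div \<sigma> cm h g = ((0, h), 0)"
  by (simp add: left_div_def ret_def)

lemma snd_left_div:
  assumes "g \<noteq> 0" and "degree g \<le> degree h"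
  shows "real (snd (left_div \<sigma> cm h g))
    \<le> I + (real (degree h) - real (degree g) + 1) * ((real (degree g) + 2) * \<tau>)"
proof (cases "h = 0")
  case True
  then show ?thesis using bounds_nonneg assms by (simp add: left_div_trivial)
next
  case False
  define u where "u = inverse (lead_coeff g)"
  let ?xs = "rev [0..<Suc (degree h - degree g)]"
  have "real (snd (left_div_step \<sigma> cm g u k x)) \<le> (real (degree g) + 2) * \<tau>" for k x
    using left_div_step(2)[OF refl, of g u k "fst x" "snd x"] assms(1)
    by (simp add: length_coeffs_degree algebra_simps)
  then have "real (snd (for_each ?xs (left_div_step \<sigma> cm g u) (0, h)))
      \<le> real (length ?xs) * ((real (degree g) + 2) * \<tau>)"
    by (intro snd_for_each_le)
  moreover have "real (length ?xs) = real (degree h) - real (degree g) + 1"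
    using assms by simp
  moreover have "real (cost_inv cm (lead_coeff g)) \<le> I"
    using assms by (intro inv_bound) simp
  moreover have "snd (left_div \<sigma> cm h g)
      = cost_inv cm (lead_coeff g) + snd (for_each ?xs (left_div_step \<sigma> cm g u) (0, h))"
    using False assms by (simp add: left_div_def inv_op_def u_def del: upt_Suc)
  ultimately show ?thesis by (simp add: algebra_simps)
qed

text \<open>The pairs \<open>(v\<^sub>0, f\<^sub>0)\<close> and \<open>(v\<^sub>1, f\<^sub>1)\<close> always generate the same submodule of \<open>R\<^sup>2\<close>, because a
  step is an elementary row operation; when \<open>f\<^sub>1 = 0\<close>, its elements \<open>(a, 0)\<close> are the multiples of
  \<open>(v\<^sub>1, 0)\<close>, which is why one cofactor is enough.\<close>

definition euclid_lattice :: "'a poly \<Rightarrow> 'a poly \<Rightarrow> 'a poly \<times> 'a poly \<times> 'a poly \<times> 'a poly \<Rightarrow> bool" where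
  "euclid_lattice f h = (\<lambda>(f0, f1, v0, v1). \<forall>a b. a \<odot> h - b \<in> LI f \<longleftrightarrow>
     (\<exists>x y. a = x \<odot> v0 + y \<odot> v1 \<and> b = x \<odot> f0 + y \<odot> f1))"

text \<open>The equation is the classical degree identity of the extended Euclidean algorithm. The
  bound on \<open>v0\<close> makes \<open>c \<odot> v1\<close> dominate \<open>v0\<close> in the
  next cofactor, so that no cancellation occurs. After the last step \<open>f1 = 0\<close>, and its
  conventional degree 0 must not enter.\<close>

definition euclid_degrees :: "nat \<Rightarrow> 'a poly \<times> 'a poly \<times> 'a poly \<times> 'a poly \<Rightarrow> bool" where
  "euclid_degrees m = (\<lambda>(f0, f1, v0, v1). f0 \<noteq> 0 \<and> v1 \<noteq> 0 \<and> degree v1 + degree f0 = m \<and>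
     (f1 \<noteq> 0 \<longrightarrow> degree f1 \<le> degree f0 \<and> (v0 = 0 \<or> degree v0 + degree f1 < m)))"

lemma fst_algorithm_A_step:
  assumes "fst (left_div \<sigma> cm f0 f1) = (c, \<rho>)"
  shows "fst (algorithm_A_step \<sigma> cm (f0, f1, v0, v1)) = (f1, \<rho>, v1, v0 - c \<odot> v1)"
  using assms by (simp add: algorithm_A_step_def fst_poly_mul fst_poly_sub)

lemma snd_algorithm_A_step:
  assumes "fst (left_div \<sigma> cm f0 f1) = (c, \<rho>)"
  shows "real (snd (algorithm_A_step \<sigma> cm (f0, f1, v0, v1))) \<le> real (snd (left_div \<sigma> cm f0 f1))
    + real (length (coeffs c)) * (real (length (coeffs v1)) * \<tau>)
    + real (length (coeffs (c \<odot> v1))) * \<tau>"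
  using assms snd_poly_mul[of c v1] snd_poly_sub[of v0 "c \<odot> v1"]
  by (simp add: algorithm_A_step_def fst_poly_mul)

lemma euclid_lattice_init: "euclid_lattice f h (f, h, 0, [:1:])"
proof -
  have "a \<odot> h - b \<in> LI f \<longleftrightarrow> (\<exists>x. b = x \<odot> f + a \<odot> h)" for a b
  proof
    assume "a \<odot> h - b \<in> LI f"
    then obtain x where "a \<odot> h - b = x \<odot> f" by (auto simp: left_principal_def)
    then have "b = (- x) \<odot> f + a \<odot> h" by (simp add: algebra_simps)
    then show "\<exists>x. b = x \<odot> f + a \<odot> h" ..
  next
    assume "\<exists>x. b = x \<odot> f + a \<odot> h"
    then obtain x where "b = x \<odot> f + a \<odot> h" ..
    then have "a \<odot> h - b = (- x) \<odot> f" by simp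
    then show "a \<odot> h - b \<in> LI f" by (simp add: left_principalI del: mult_minus_left)
  qed
  then show ?thesis by (simp add: euclid_lattice_def)
qed

lemma euclid_lattice_step:
  assumes "f1 \<noteq> 0" and "euclid_lattice f h (f0, f1, v0, v1)"
  shows "euclid_lattice f h (fst (algorithm_A_step \<sigma> cm (f0, f1, v0, v1)))"
proof -
  obtain c \<rho> where c: "fst (left_div \<sigma> cm f0 f1) = (c, \<rho>)" by fastforce
  have f0: "f0 = c \<odot> f1 + \<rho>" using left_div_correct(1)[OF assms(1) c] .
  have "(\<exists>x y. a = x \<odot> v0 + y \<odot> v1 \<and> b = x \<odot> f0 + y \<odot> f1) \<longleftrightarrow>
      (\<exists>x y. a = x \<odot> v1 + y \<odot> (v0 - c \<odot> v1) \<and> b = x \<odot> f1 + y \<odot> \<rho>)" for a b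
  proof
    assume "\<exists>x y. a = x \<odot> v0 + y \<odot> v1 \<and> b = x \<odot> f0 + y \<odot> f1"
    then obtain x y where "a = x \<odot> v0 + y \<odot> v1" "b = x \<odot> f0 + y \<odot> f1" by blast
    then have "a = (x \<odot> c + y) \<odot> v1 + x \<odot> (v0 - c \<odot> v1) \<and> b = (x \<odot> c + y) \<odot> f1 + x \<odot> \<rho>"
      by (simp add: f0 mult_assoc algebra_simps)
    then show "\<exists>x y. a = x \<odot> v1 + y \<odot> (v0 - c \<odot> v1) \<and> b = x \<odot> f1 + y \<odot> \<rho>" by blast
  next
    assume "\<exists>x y. a = x \<odot> v1 + y \<odot> (v0 - c \<odot> v1) \<and> b = x \<odot> f1 + y \<odot> \<rho>"
    then obtain x y where "a = x \<odot> v1 + y \<odot> (v0 - c \<odot> v1)" "b = x \<odot> f1 + y \<odot> \<rho>" by blast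
    then have "a = y \<odot> v0 + (x - y \<odot> c) \<odot> v1 \<and> b = y \<odot> f0 + (x - y \<odot> c) \<odot> f1"
      by (simp add: f0 mult_assoc algebra_simps)
    then show "\<exists>x y. a = x \<odot> v0 + y \<odot> v1 \<and> b = x \<odot> f0 + y \<odot> f1" by blast
  qed
  then show ?thesis
    using assms(2) by (simp add: fst_algorithm_A_step[OF c] euclid_lattice_def)
qed

lemma euclid_degrees_step:
  assumes "f1 \<noteq> 0" and inv: "euclid_degrees m (f0, f1, v0, v1)"
    and st: "fst (algorithm_A_step \<sigma> cm (f0, f1, v0, v1)) = (f0', f1', v0', v1')"
  shows "euclid_degrees m (f0', f1', v0', v1')" and "f0' = f1"
    and "f1' = 0 \<or> degree f1' < degree f1"
    and "real (snd (algorithm_A_step \<sigma> cm (f0, f1, v0, v1))) \<le> I +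
      (real (degree f0) - real (degree f1) + 1) * ((real (degree f1) + 2 * real (degree v1) + 4) * \<tau>)"
proof -
  obtain c \<rho> where c: "fst (left_div \<sigma> cm f0 f1) = (c, \<rho>)" by fastforce
  note div = left_div_correct[OF assms(1) c]
  have eqs: "f0' = f1" "f1' = \<rho>" "v0' = v1" "v1' = v0 - c \<odot> v1"
    using st fst_algorithm_A_step[OF c, of v0 v1] by auto
  have inv': "f0 \<noteq> 0" "v1 \<noteq> 0" "degree v1 + degree f0 = m" "degree f1 \<le> degree f0"
      "v0 = 0 \<or> degree v0 + degree f1 < m"
    using inv assms(1) by (auto simp: euclid_degrees_def)
  have c0: "c \<noteq> 0"
    using div inv' by auto
  have degc: "degree c + degree f1 = degree f0"
  proof -
    have "degree (c \<odot> f1 + \<rho>) = degree (c \<odot> f1)"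
      using div(2) c0 assms(1) degree_mult[of c f1] degree_add_eq_left[of \<rho> "c \<odot> f1"]
      by (cases "\<rho> = 0") auto
    then show ?thesis using div(1) degree_mult[OF c0 assms(1)] by simp
  qed
  have cv: "c \<odot> v1 \<noteq> 0" "degree (c \<odot> v1) = degree c + degree v1"
    using c0 inv' degree_mult by auto
  have v1': "v1' \<noteq> 0 \<and> degree v1' = degree c + degree v1"
  proof (cases "v0 = 0")
    case True
    then show ?thesis using cv eqs by simp
  next
    case False
    then have "degree v0 < degree (c \<odot> v1)" using inv' cv degc by auto
    then have "degree (v0 + (- (c \<odot> v1))) = degree (c \<odot> v1)"
      using degree_add_eq_right[of v0 "- (c \<odot> v1)"] by simp
    then show ?thesis using cv eqs \<open>degree v0 < degree (c \<odot> v1)\<close> by auto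
  qed
  show "f0' = f1" by (fact eqs)
  show f1': "f1' = 0 \<or> degree f1' < degree f1" using div eqs by simp
  show "euclid_degrees m (f0', f1', v0', v1')"
    unfolding euclid_degrees_def using v1' f1' inv' eqs degc assms(1) by auto
  have lens: "real (length (coeffs c)) = real (degree f0) - real (degree f1) + 1"
    "real (length (coeffs v1)) = real (degree v1) + 1"
    "real (length (coeffs (c \<odot> v1))) = real (degree f0) - real (degree f1) + real (degree v1) + 1"
    using c0 inv' cv degc by (auto simp: length_coeffs_degree)
  define Q where "Q = real (degree f0) - real (degree f1)"
  have "0 \<le> Q" using inv' by (simp add: Q_def)
  \<comment> \<open>The subtraction of \<open>c \<odot> v1\<close> is charged like a second product
    of \<open>c\<close> and \<open>v1\<close>, whence the factor 2 at \<open>degree v1\<close> in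
    the bound.\<close>
  have "Q + real (degree v1) + 1 \<le> (Q + 1) * (real (degree v1) + 1)"
    using \<open>0 \<le> Q\<close> by (simp add: algebra_simps)
  then have "(Q + real (degree v1) + 1) * \<tau> \<le> (Q + 1) * (real (degree v1) + 1) * \<tau>"
    using bounds_nonneg by (intro mult_right_mono)
  moreover have "real (snd (left_div \<sigma> cm f0 f1)) \<le> I + (Q + 1) * ((real (degree f1) + 2) * \<tau>)"
    using snd_left_div[OF assms(1) inv'(4)] by (simp add: Q_def)
  moreover have "real (snd (algorithm_A_step \<sigma> cm (f0, f1, v0, v1))) \<le> real (snd (left_div \<sigma> cm f0 f1))
      + (Q + 1) * ((real (degree v1) + 1) * \<tau>) + (Q + real (degree v1) + 1) * \<tau>"
    using snd_algorithm_A_step[OF c, of v0 v1] unfolding lens Q_def by simp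
  ultimately show "real (snd (algorithm_A_step \<sigma> cm (f0, f1, v0, v1))) \<le> I +
      (real (degree f0) - real (degree f1) + 1) * ((real (degree f1) + 2 * real (degree v1) + 4) * \<tau>)"
    unfolding Q_def[symmetric] by (simp add: algebra_simps)
qed

text \<open>Amortized price of lowering \<open>degree f0\<close> by one. If a step lowers it by Q >=
  1, then Q + 1 <= 2 Q, and the second factor of the step cost is at most 4 (m + 1) because
  \<open>degree f1 + degree v1 \<le> m\<close>; the product gives 8.\<close>

definition euclid_weight :: "nat \<Rightarrow> real" where
  "euclid_weight m = I + 8 * (real m + 1) * \<tau>"

text \<open>Amortization with potential \<open>degree f0\<close>: after a start at potential at most
  \<open>k\<close> and price \<open>c\<close>, each lost degree is paid for by one weight. The
  strict inequality of degrees, which may fail in the input, makes each division lower the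
  potential; \<open>k\<close> and \<open>c\<close> absorb the exceptional initial steps.\<close>

definition euclid_good :: "'a poly \<Rightarrow> 'a poly \<Rightarrow> nat \<Rightarrow> real \<Rightarrow>
    'a poly \<times> 'a poly \<times> 'a poly \<times> 'a poly \<Rightarrow> nat \<Rightarrow> bool" where
  "euclid_good f h k c = (\<lambda>(f0, f1, v0, v1) t.
     euclid_lattice f h (f0, f1, v0, v1) \<and> euclid_degrees (degree f) (f0, f1, v0, v1) \<and>
     (f1 \<noteq> 0 \<longrightarrow> degree f1 < degree f0) \<and> degree f0 \<le> k \<and>
     real t \<le> c + (real k - real (degree f0)) * euclid_weight (degree f))"

lemma euclid_weight_nonneg: "0 \<le> euclid_weight m"
  using bounds_nonneg by (simp add: euclid_weight_def)

lemma euclid_good_step: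
  assumes good: "euclid_good f h k c (f0, f1, v0, v1) t" and f1: "f1 \<noteq> 0"
    and st: "fst (algorithm_A_step \<sigma> cm (f0, f1, v0, v1)) = (f0', f1', v0', v1')"
  shows "euclid_good f h k c (f0', f1', v0', v1') (t + snd (algorithm_A_step \<sigma> cm (f0, f1, v0, v1)))"
proof -
  let ?s = "snd (algorithm_A_step \<sigma> cm (f0, f1, v0, v1))"
  let ?w = "euclid_weight (degree f)"
  have good': "euclid_lattice f h (f0, f1, v0, v1)" "euclid_degrees (degree f) (f0, f1, v0, v1)"
    "degree f1 < degree f0" "degree f0 \<le> k" "degree v1 + degree f0 = degree f"
    "real t \<le> c + (real k - real (degree f0)) * ?w"
    using good f1 by (auto simp: euclid_good_def euclid_degrees_def)
  note steps = euclid_degrees_step[OF f1 good'(2) st]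
  define Q where "Q = real (degree f0) - real (degree f1)"
  have Q: "1 \<le> Q" using good' by (simp add: Q_def)
  have "real ?s \<le> I + (Q + 1) * ((real (degree f1) + 2 * real (degree v1) + 4) * \<tau>)"
    using steps(4) by (simp add: Q_def)
  also have "\<dots> \<le> Q * I + (2 * Q) * ((4 * (real (degree f) + 1)) * \<tau>)"
  proof (intro add_mono mult_mono mult_right_mono)
    show "I \<le> Q * I" using mult_right_mono[OF Q, of I] bounds_nonneg by simp
    show "real (degree f1) + 2 * real (degree v1) + 4 \<le> 4 * (real (degree f) + 1)"
      using good'(3) by (simp flip: good'(5))
  qed (use Q bounds_nonneg in auto)
  also have "\<dots> = Q * ?w" by (simp add: euclid_weight_def algebra_simps)
  finally have "real (t + ?s) \<le> c + (real k - real (degree f0)) * ?w + Q * ?w"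
    using good' by simp
  also have "\<dots> = c + (real k - real (degree f1)) * ?w"
    by (simp add: Q_def algebra_simps)
  finally show ?thesis
    using good' steps euclid_lattice_step[OF f1 good'(1)] st by (auto simp: euclid_good_def)
qed

lemma algorithm_A_result:
  assumes loop: "counted_while (\<lambda>(f0, f1, v0, v1). f1 \<noteq> 0) (algorithm_A_step \<sigma> cm)
      (fst (algorithm_A_step \<sigma> cm (f, h, 0, [:1:]))) = Some ((f0, f1, v0, v1), t)"
    and good: "euclid_good f h k c (f0, f1, v0, v1) t" and "f1 = 0"
  shows "v1 \<noteq> 0" "degree v1 + degree f0 = degree f" "degree f0 \<le> k"
    "\<And>a. a \<odot> h \<in> LI f \<longleftrightarrow> a \<in> LI v1"
    "fst (algorithm_A \<sigma> cm f h) = v1"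
    "real (snd (algorithm_A \<sigma> cm f h)) \<le> real (snd (algorithm_A_step \<sigma> cm (f, h, 0, [:1:])))
      + c + (real k - real (degree f0)) * euclid_weight (degree f)"
proof -
  show "v1 \<noteq> 0" "degree v1 + degree f0 = degree f" "degree f0 \<le> k"
    using good by (auto simp: euclid_good_def euclid_degrees_def)
  have "f0 \<noteq> 0" using good by (auto simp: euclid_good_def euclid_degrees_def)
  show "a \<odot> h \<in> LI f \<longleftrightarrow> a \<in> LI v1" for a
  proof -
    have "a \<odot> h - 0 \<in> LI f \<longleftrightarrow> (\<exists>x y. a = x \<odot> v0 + y \<odot> v1 \<and> 0 = x \<odot> f0 + y \<odot> f1)"
      using good unfolding euclid_good_def euclid_lattice_def by blast
    then show ?thesis
      using \<open>f0 \<noteq> 0\<close> \<open>f1 = 0\<close> by (auto simp: left_principal_def)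
  qed
  show "fst (algorithm_A \<sigma> cm f h) = v1"
    using loop by (simp add: algorithm_A_def)
  show "real (snd (algorithm_A \<sigma> cm f h)) \<le> real (snd (algorithm_A_step \<sigma> cm (f, h, 0, [:1:])))
      + c + (real k - real (degree f0)) * euclid_weight (degree f)"
    using loop good by (simp add: algorithm_A_def euclid_good_def)
qed

text \<open>\<open>Suc\<close> separates nonzero constants from 0, both of which have degree
  0.\<close>

definition loop_measure :: "'a poly \<times> 'a poly \<times> 'a poly \<times> 'a poly \<Rightarrow> nat" where
  "loop_measure = (\<lambda>(f0, f1, v0, v1). if f1 = 0 then 0 else Suc (degree f1))"

lemma algorithm_A_step_measure:
  assumes "f1 \<noteq> 0"
  shows "loop_measure (fst (algorithm_A_step \<sigma> cm (f0, f1, v0, v1))) < loop_measure (f0, f1, v0, v1)"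
proof -
  obtain c \<rho> where c: "fst (left_div \<sigma> cm f0 f1) = (c, \<rho>)" by fastforce
  show ?thesis
    using left_div_correct(2)[OF assms c] assms by (auto simp: fst_algorithm_A_step[OF c] loop_measure_def)
qed

text \<open>The first division is priced separately, after which the potential is
  \<open>degree h\<close>. The last nonzero remainder has degree \<open>degree f - degree v\<close>,
  so only \<open>degree h + degree v - degree f\<close> weights are spent. Thus an \<open>h\<close>
  of small degree allows only few divisions, however large \<open>f\<close> is.\<close>

lemma algorithm_A_small:
  assumes "f \<noteq> 0" "h \<noteq> 0" "degree h \<le> degree f"
  shows "\<exists>v t. algorithm_A \<sigma> cm f h = (v, t) \<and> v \<noteq> 0 \<and> degree v \<le> degree f \<and>
    degree f \<le> degree v + degree h \<and> (\<forall>a. a \<odot> h \<in> LI f \<longleftrightarrow> a \<in> LI v) \<and>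
    real t \<le> I + (real (degree f) - real (degree h) + 1) * ((real (degree h) + 4) * \<tau>)
      + (real (degree h) + real (degree v) - real (degree f)) * euclid_weight (degree f)"
proof -
  let ?st = "algorithm_A_step \<sigma> cm (f, h, 0, [:1:])"
  obtain f0 f1 v0 v1 where st: "fst ?st = (f0, f1, v0, v1)" by (cases "fst ?st")
  have "euclid_degrees (degree f) (f, h, 0, [:1:])"
    using assms by (simp add: euclid_degrees_def)
  note steps = euclid_degrees_step[OF assms(2) this st]
  let ?Inv = "euclid_good f h (degree h) 0"
  have "\<exists>y t. counted_while (\<lambda>(f0, f1, v0, v1). f1 \<noteq> 0) (algorithm_A_step \<sigma> cm) (fst ?st) = Some (y, t)
      \<and> ?Inv y t \<and> \<not> (\<lambda>(f0, f1, v0, v1). f1 \<noteq> 0) y"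
  proof (rule counted_while_rule[where m = loop_measure])
    fix x t assume *: "?Inv x t" "case x of (f0, f1, v0, v1) \<Rightarrow> f1 \<noteq> 0"
    obtain f0 f1 v0 v1 where x: "x = (f0, f1, v0, v1)" by (cases x)
    obtain f0' f1' v0' v1' where x': "fst (algorithm_A_step \<sigma> cm x) = (f0', f1', v0', v1')"
      by (cases "fst (algorithm_A_step \<sigma> cm x)")
    have "f1 \<noteq> 0" using *(2) x by simp
    then show "?Inv (fst (algorithm_A_step \<sigma> cm x)) (t + snd (algorithm_A_step \<sigma> cm x)) \<and>
      loop_measure (fst (algorithm_A_step \<sigma> cm x)) < loop_measure x"
      using euclid_good_step[OF *(1)[unfolded x] _ x'[unfolded x]]
        algorithm_A_step_measure[of f1 f0 v0 v1] x' x by simp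
  next
    show "?Inv (fst ?st) 0"
      using steps euclid_lattice_step[OF assms(2) euclid_lattice_init, of f]
      unfolding st by (auto simp: euclid_good_def)
  qed
  then obtain g0 w0 w1 t where "counted_while (\<lambda>(f0, f1, v0, v1). f1 \<noteq> 0) (algorithm_A_step \<sigma> cm)
      (fst ?st) = Some ((g0, 0, w0, w1), t)" "?Inv (g0, 0, w0, w1) t"
    by auto
  note res = algorithm_A_result[OF this refl]
  have "real (snd ?st) \<le> I + (real (degree f) - real (degree h) + 1) * ((real (degree h) + 4) * \<tau>)"
    using steps(4) by simp
  then have "real (snd (algorithm_A \<sigma> cm f h)) \<le>
      I + (real (degree f) - real (degree h) + 1) * ((real (degree h) + 4) * \<tau>)
      + (real (degree h) - real (degree g0)) * euclid_weight (degree f)"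
    using res(6) by simp
  moreover have "real (degree h) - real (degree g0) = real (degree h) + real (degree w1) - real (degree f)"
    using res(2) by linarith
  ultimately have "real (snd (algorithm_A \<sigma> cm f h)) \<le>
      I + (real (degree f) - real (degree h) + 1) * ((real (degree h) + 4) * \<tau>)
      + (real (degree h) + real (degree w1) - real (degree f)) * euclid_weight (degree f)"
    by simp
  then show ?thesis
    using res(1-5) by (intro exI[of _ w1] exI[of _ "snd (algorithm_A \<sigma> cm f h)"]) (auto simp: prod_eq_iff)
qed

text \<open>The first step has quotient 0 and merely swaps the arguments at no cost; the division of
  \<open>h\<close> by \<open>f\<close> comes next and is free of cofactor work because
  \<open>v1 = 0\<close>. From then on all cost is measured by the degree of the result.\<close>

lemma algorithm_A_large:
  assumes "f \<noteq> 0" "degree f < degree h"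
  shows "\<exists>v t. algorithm_A \<sigma> cm f h = (v, t) \<and> v \<noteq> 0 \<and> degree v \<le> degree f \<and>
    (\<forall>a. a \<odot> h \<in> LI f \<longleftrightarrow> a \<in> LI v) \<and>
    real t \<le> I + (real (degree h) - real (degree f) + 1) * ((real (degree f) + 2) * \<tau>)
      + real (degree v) * euclid_weight (degree f)"
proof -
  have h: "h \<noteq> 0" using assms by auto
  let ?st = "algorithm_A_step \<sigma> cm (f, h, 0, [:1:])"
  define c where "c = I + (real (degree h) - real (degree f) + 1) * ((real (degree f) + 2) * \<tau>)"
  have st: "?st = ((h, f, [:1:], 0), 0)"
    using assms by (simp add: algorithm_A_step_def left_div_trivial poly_mul_def poly_sub_def
        ret_def counted_bind_def)
  let ?good = "euclid_good f h (degree f) c"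
  let ?Inv = "\<lambda>x t. x = (h, f, [:1:], 0) \<and> t = 0 \<or> ?good x t"
  have first: "?good (fst (algorithm_A_step \<sigma> cm (h, f, [:1:], 0)))
      (snd (algorithm_A_step \<sigma> cm (h, f, [:1:], 0)))"
  proof -
    obtain q \<rho> where q: "fst (left_div \<sigma> cm h f) = (q, \<rho>)" by fastforce
    have "euclid_lattice f h (fst (algorithm_A_step \<sigma> cm (h, f, [:1:], 0)))"
      using euclid_lattice_step[OF assms(1), of f h h "[:1:]" 0]
        euclid_lattice_step[OF h euclid_lattice_init, of f] st by simp
    moreover have "fst (algorithm_A_step \<sigma> cm (h, f, [:1:], 0)) = (f, \<rho>, 0, [:1:])"
      using fst_algorithm_A_step[OF q] by simp
    moreover have "real (snd (algorithm_A_step \<sigma> cm (h, f, [:1:], 0))) \<le> c"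
      using snd_algorithm_A_step[OF q, of "[:1:]" 0] snd_left_div[of f h] assms by (simp add: c_def)
    ultimately show ?thesis
      using left_div_correct(2)[OF assms(1) q] assms(1)
      by (auto simp: euclid_good_def euclid_degrees_def)
  qed
  have "\<exists>y t. counted_while (\<lambda>(f0, f1, v0, v1). f1 \<noteq> 0) (algorithm_A_step \<sigma> cm) (fst ?st) = Some (y, t)
      \<and> ?Inv y t \<and> \<not> (\<lambda>(f0, f1, v0, v1). f1 \<noteq> 0) y"
  proof (rule counted_while_rule[where m = loop_measure])
    fix x t assume *: "?Inv x t" "case x of (f0, f1, v0, v1) \<Rightarrow> f1 \<noteq> 0"
    obtain f0 f1 v0 v1 where x: "x = (f0, f1, v0, v1)" by (cases x)
    obtain f0' f1' v0' v1' where x': "fst (algorithm_A_step \<sigma> cm x) = (f0', f1', v0', v1')"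
      by (cases "fst (algorithm_A_step \<sigma> cm x)")
    have f1: "f1 \<noteq> 0" using *(2) x by simp
    have "?good (fst (algorithm_A_step \<sigma> cm x)) (t + snd (algorithm_A_step \<sigma> cm x))"
      using *(1)
    proof
      assume "x = (h, f, [:1:], 0) \<and> t = 0"
      then show ?thesis using first by simp
    next
      assume "?good x t"
      then show ?thesis
        using euclid_good_step[OF _ f1 x'[unfolded x]] x' x by simp
    qed
    then show "?Inv (fst (algorithm_A_step \<sigma> cm x)) (t + snd (algorithm_A_step \<sigma> cm x)) \<and>
      loop_measure (fst (algorithm_A_step \<sigma> cm x)) < loop_measure x"
      using algorithm_A_step_measure[OF f1, of f0 v0 v1] x by simp
  qed (simp add: st)
  then obtain g0 w0 w1 t where "counted_while (\<lambda>(f0, f1, v0, v1). f1 \<noteq> 0) (algorithm_A_step \<sigma> cm)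
      (fst ?st) = Some ((g0, 0, w0, w1), t)" "?good (g0, 0, w0, w1) t"
    using assms(1) by auto
  note res = algorithm_A_result[OF this refl]
  have "real (degree f) - real (degree g0) = real (degree w1)"
    using res(2) by linarith
  then have "real (snd (algorithm_A \<sigma> cm f h)) \<le> c + real (degree w1) * euclid_weight (degree f)"
    using res(6) st by simp
  then show ?thesis
    using res(1-5) unfolding c_def
    by (intro exI[of _ w1] exI[of _ "snd (algorithm_A \<sigma> cm f h)"]) (auto simp: prod_eq_iff)
qed

section \<open>Tests and updates of Algorithm B\<close>

lemma euclid_weight_mono: "m \<le> n \<Longrightarrow> euclid_weight m \<le> euclid_weight n"
  using bounds_nonneg unfolding euclid_weight_def
  by (intro add_left_mono mult_right_mono mult_left_mono) auto

lemma left_div_remainder_0_iff: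
  assumes "g \<noteq> 0"
  shows "snd (fst (left_div \<sigma> cm h g)) = 0 \<longleftrightarrow> h \<in> LI g"
proof -
  obtain q \<rho> where q: "fst (left_div \<sigma> cm h g) = (q, \<rho>)" by fastforce
  note div = left_div_correct[OF assms q]
  have "\<rho> = h - q \<odot> g" using div(1) by simp
  then have "h \<in> LI g \<longleftrightarrow> \<rho> \<in> LI g"
    using left_principalI[of q g] left_principal_diff[of h g "q \<odot> g"] left_principal_add[of \<rho> g "q \<odot> g"]
    by auto
  also have "\<dots> \<longleftrightarrow> \<rho> = 0"
    using div(2) degree_left_principal[of \<rho> g] left_principal_zero[of g]
    by (cases "\<rho> = 0") auto
  finally show ?thesis using q by simp
qed

text \<open>The quotient of \<open>g \<odot> d\<close> by \<open>g\<close> only has degree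
  \<open>degree d\<close>; hence a cost linear in \<open>degree g\<close>. The 3 is 1 for the
  product and 2 for the division, where \<open>degree g + 2\<close> is at most twice
  \<open>degree g + 1\<close>.\<close>

lemma check_cost:
  assumes "g \<noteq> 0" "degree d \<le> \<delta>"
  shows "real (snd (poly_mul \<sigma> cm g d)) + real (snd (left_div \<sigma> cm (g \<odot> d) g))
    \<le> I + 3 * (real \<delta> + 1) * (real (degree g) + 1) * \<tau>"
proof (cases "d = 0")
  case True
  then show ?thesis
    using snd_poly_mul[of g d] bounds_nonneg by (simp add: left_div_trivial)
next
  case False
  have deg: "degree (g \<odot> d) = degree g + degree d" using degree_mult assms False by simp
  have "real (snd (left_div \<sigma> cm (g \<odot> d) g)) \<le> I + (real (degree d) + 1) * ((real (degree g) + 2) * \<tau>)"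
    using snd_left_div[OF assms(1), of "g \<odot> d"] by (simp add: deg)
  moreover have "(real (degree d) + 1) * ((real (degree g) + 2) * \<tau>)
      \<le> (real \<delta> + 1) * ((2 * (real (degree g) + 1)) * \<tau>)"
    using assms bounds_nonneg by (intro mult_mono mult_right_mono) auto
  moreover have "real (snd (poly_mul \<sigma> cm g d)) \<le> (real (degree g) + 1) * ((real (degree d) + 1) * \<tau>)"
    using snd_poly_mul[of g d] assms False by (simp add: length_coeffs_degree add.commute)
  moreover have "(real (degree g) + 1) * ((real (degree d) + 1) * \<tau>)
      \<le> (real (degree g) + 1) * ((real \<delta> + 1) * \<tau>)"
    using assms bounds_nonneg by (intro mult_left_mono mult_right_mono) auto
  ultimately show ?thesis by (simp add: algebra_simps)
qed

text \<open>After the first nontrivial division at most \<delta> degrees can be lost: the divisor is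
  \<open>d\<close> if \<open>degree d \<le> degree g\<close>, and otherwise \<open>g\<close> itself
  has degree below \<delta>. The coefficients of \<tau> in the two cases are 9 \<delta> + 4 and 10
  \<delta> + 2, coarsened to 10 \<delta> + 4.\<close>

lemma first_euclid:
  assumes "g \<noteq> 0" "d \<noteq> 0" "degree d \<le> \<delta>"
  shows "\<exists>v t. algorithm_A \<sigma> cm g d = (v, t) \<and> v \<noteq> 0 \<and> degree v \<le> degree g \<and>
    degree g \<le> degree v + \<delta> \<and> (\<forall>a. a \<odot> d \<in> LI g \<longleftrightarrow> a \<in> LI v) \<and>
    real t \<le> (real \<delta> + 1) * I + (10 * real \<delta> + 4) * ((real (degree g) + 1) * \<tau>)"
proof (cases "degree d \<le> degree g")
  case True
  let ?m = "real (degree g)" and ?w = "euclid_weight (degree g)"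
  obtain v t where v: "algorithm_A \<sigma> cm g d = (v, t)" "v \<noteq> 0" "degree v \<le> degree g"
    "degree g \<le> degree v + degree d" "\<forall>a. a \<odot> d \<in> LI g \<longleftrightarrow> a \<in> LI v"
    "real t \<le> I + (?m - real (degree d) + 1) * ((real (degree d) + 4) * \<tau>)
      + (real (degree d) + real (degree v) - ?m) * ?w"
    using algorithm_A_small[OF assms(1,2) True] by blast
  have "(?m - real (degree d) + 1) * ((real (degree d) + 4) * \<tau>) \<le> (?m + 1) * ((real \<delta> + 4) * \<tau>)"
    using assms True bounds_nonneg by (intro mult_mono mult_right_mono) auto
  moreover have "(real (degree d) + real (degree v) - ?m) * ?w \<le> real \<delta> * ?w"
    using assms v euclid_weight_nonneg by (intro mult_right_mono) linarith+
  ultimately have "real t \<le> I + (?m + 1) * ((real \<delta> + 4) * \<tau>) + real \<delta> * ?w"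
    using v by linarith
  also have "\<dots> = (real \<delta> + 1) * I + (9 * real \<delta> + 4) * ((?m + 1) * \<tau>)"
    by (simp add: euclid_weight_def algebra_simps)
  also have "\<dots> \<le> (real \<delta> + 1) * I + (10 * real \<delta> + 4) * ((?m + 1) * \<tau>)"
    using bounds_nonneg by (intro add_left_mono mult_right_mono) auto
  finally have "real t \<le> (real \<delta> + 1) * I + (10 * real \<delta> + 4) * ((?m + 1) * \<tau>)" .
  then show ?thesis using v assms
    by (intro exI[of _ v] exI[of _ t]) auto
next
  case False
  let ?m = "real (degree g)" and ?w = "euclid_weight (degree g)"
  obtain v t where v: "algorithm_A \<sigma> cm g d = (v, t)" "v \<noteq> 0" "degree v \<le> degree g"
    "\<forall>a. a \<odot> d \<in> LI g \<longleftrightarrow> a \<in> LI v"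
    "real t \<le> I + (real (degree d) - ?m + 1) * ((?m + 2) * \<tau>) + real (degree v) * ?w"
    using algorithm_A_large[OF assms(1), of d] False by (auto simp: not_le)
  have "(real (degree d) - ?m + 1) * ((?m + 2) * \<tau>) \<le> (real \<delta> + 1) * ((2 * (?m + 1)) * \<tau>)"
    using assms False bounds_nonneg by (intro mult_mono mult_right_mono) auto
  moreover have "real (degree v) * ?w \<le> real \<delta> * ?w"
    using assms False v euclid_weight_nonneg by (intro mult_right_mono) auto
  ultimately have "real t \<le> I + (real \<delta> + 1) * ((2 * (?m + 1)) * \<tau>) + real \<delta> * ?w"
    using v by linarith
  also have "\<dots> = (real \<delta> + 1) * I + (10 * real \<delta> + 2) * ((?m + 1) * \<tau>)"
    by (simp add: euclid_weight_def algebra_simps)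
  also have "\<dots> \<le> (real \<delta> + 1) * I + (10 * real \<delta> + 4) * ((?m + 1) * \<tau>)"
    using bounds_nonneg by (intro add_left_mono mult_right_mono) auto
  finally have "real t \<le> (real \<delta> + 1) * I + (10 * real \<delta> + 4) * ((?m + 1) * \<tau>)" .
  then show ?thesis using v assms False
    by (intro exI[of _ v] exI[of _ t]) auto
qed

text \<open>The two arguments differ in degree by at most \<delta>, so the first nontrivial quotient
  is short; the other divisions lose at most \<open>degree v\<close> degrees altogether, which is
  the degree gained by the least common multiple \<open>v \<odot> g\<close>. This is what lets an
  update be charged to its gain.\<close>

lemma second_euclid:
  assumes "g \<noteq> 0" "p \<noteq> 0" "degree p \<le> degree g" "degree g \<le> degree p + \<delta>"
  shows "\<exists>v t. algorithm_A \<sigma> cm p g = (v, t) \<and> v \<noteq> 0 \<and> (\<forall>a. a \<odot> g \<in> LI p \<longleftrightarrow> a \<in> LI v) \<and>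
    real t \<le> (1 + real (degree v)) * I
      + (4 * real \<delta> + 4 + 8 * real (degree v)) * ((real (degree g) + 1) * \<tau>)"
proof -
  let ?m = "real (degree g)" and ?w = "euclid_weight (degree g)"
  have "\<exists>v t. algorithm_A \<sigma> cm p g = (v, t) \<and> v \<noteq> 0 \<and> (\<forall>a. a \<odot> g \<in> LI p \<longleftrightarrow> a \<in> LI v) \<and>
    real t \<le> I + (real \<delta> + 1) * ((4 * (?m + 1)) * \<tau>) + real (degree v) * ?w"
  proof (cases "degree p = degree g")
    case True
    obtain v t where v: "algorithm_A \<sigma> cm p g = (v, t)" "v \<noteq> 0"
      "\<forall>a. a \<odot> g \<in> LI p \<longleftrightarrow> a \<in> LI v"
      "real t \<le> I + (?m + 4) * \<tau> + real (degree v) * ?w"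
      using algorithm_A_small[OF assms(2,1)] True by auto
    have "(?m + 4) * \<tau> \<le> (4 * (?m + 1)) * \<tau>"
      using bounds_nonneg by (intro mult_right_mono) auto
    also have "\<dots> \<le> (real \<delta> + 1) * ((4 * (?m + 1)) * \<tau>)"
      using bounds_nonneg mult_right_mono[of 1 "real \<delta> + 1" "(4 * (?m + 1)) * \<tau>"] by simp
    finally show ?thesis using v by (intro exI[of _ v] exI[of _ t]) auto
  next
    case False
    then have lt: "degree p < degree g" using assms by simp
    obtain v t where v: "algorithm_A \<sigma> cm p g = (v, t)" "v \<noteq> 0"
      "\<forall>a. a \<odot> g \<in> LI p \<longleftrightarrow> a \<in> LI v"
      "real t \<le> I + (?m - real (degree p) + 1) * ((real (degree p) + 2) * \<tau>)
        + real (degree v) * euclid_weight (degree p)"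
      using algorithm_A_large[OF assms(2) lt] by auto
    have "(?m - real (degree p) + 1) * ((real (degree p) + 2) * \<tau>) \<le> (real \<delta> + 1) * ((4 * (?m + 1)) * \<tau>)"
      using assms lt bounds_nonneg by (intro mult_mono mult_right_mono) auto
    moreover have "real (degree v) * euclid_weight (degree p) \<le> real (degree v) * ?w"
      using lt by (intro mult_left_mono euclid_weight_mono) auto
    ultimately show ?thesis using v by (intro exI[of _ v] exI[of _ t]) auto
  qed
  moreover have "I + (real \<delta> + 1) * ((4 * (?m + 1)) * \<tau>) + e * ?w
      = (1 + e) * I + (4 * real \<delta> + 4 + 8 * e) * ((?m + 1) * \<tau>)" for e
    by (simp add: euclid_weight_def algebra_simps)
  ultimately show ?thesis by simp
qed

lemma degree_0_left_principal:
  assumes "v \<noteq> 0" "degree v = 0"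
  shows "a \<in> LI v"
proof -
  obtain c where c: "v = [:c:]" using assms(2) degree_eq_zeroE by blast
  have "[:inverse c:] \<odot> v = [:1:]"
    using assms(1) monom_mult_monom[of "inverse c" 0 c 0] by (simp add: c monom_0)
  then have "a = a \<odot> [:inverse c:] \<odot> v" by (simp add: mult_assoc)
  then show ?thesis by (metis left_principalI)
qed

lemma algorithm_B_step_good:
  assumes "g \<noteq> 0" "g \<odot> ds ! (i - 1) \<in> LI g" "degree (ds ! (i - 1)) \<le> \<delta>"
  shows "fst (algorithm_B_step \<sigma> cm ds (g, i)) = (g, i + 1)"
    and "real (snd (algorithm_B_step \<sigma> cm ds (g, i)))
      \<le> I + 3 * (real \<delta> + 1) * (real (degree g) + 1) * \<tau>"
proof -
  obtain q t where "left_div \<sigma> cm (g \<odot> ds ! (i - 1)) g = ((q, 0), t)"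
    using left_div_remainder_0_iff[OF assms(1), of "g \<odot> ds ! (i - 1)"] assms(2)
    by (metis prod.collapse)
  then show "fst (algorithm_B_step \<sigma> cm ds (g, i)) = (g, i + 1)"
    and "real (snd (algorithm_B_step \<sigma> cm ds (g, i)))
      \<le> I + 3 * (real \<delta> + 1) * (real (degree g) + 1) * \<tau>"
    using check_cost[OF assms(1,3)] by (simp_all add: algorithm_B_step_def fst_poly_mul Let_def)
qed

text \<open>Since R g_d consists of the a with a d in Rg, the new ideal is the part of Rg that
  \<open>d\<close> multiplies into Rg. Writing its elements as b g, the condition on b is b g in R
  g_d, whose solutions are Rv. A constant \<open>v\<close> would put \<open>g \<odot> d\<close> into
  Rg, so an update always gains a degree.\<close>

lemma algorithm_B_step_bad:
  assumes g: "g \<noteq> 0" and d: "d = ds ! (i - 1)" and "g \<odot> d \<notin> LI g" "degree d \<le> \<delta>"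
  shows "\<exists>g' e. fst (algorithm_B_step \<sigma> cm ds (g, i)) = (g', 1) \<and> g' \<noteq> 0 \<and> e \<ge> 1 \<and>
      degree g' = degree g + e \<and> LI g' = {a \<in> LI g. a \<odot> d \<in> LI g} \<and>
      real (snd (algorithm_B_step \<sigma> cm ds (g, i)))
        \<le> (I + 3 * (real \<delta> + 1) * (real (degree g) + 1) * \<tau>)
          + real e * ((real \<delta> + 3) * I + 18 * (real \<delta> + 1) * (real (degree g) + 1) * \<tau>)"
proof -
  let ?m = "real (degree g)"
  have d0: "d \<noteq> 0" using assms left_principal_zero by auto
  obtain p t1 where p: "algorithm_A \<sigma> cm g d = (p, t1)" "p \<noteq> 0" "degree p \<le> degree g"
      "degree g \<le> degree p + \<delta>" "\<And>a. a \<odot> d \<in> LI g \<longleftrightarrow> a \<in> LI p"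
      "real t1 \<le> (real \<delta> + 1) * I + (10 * real \<delta> + 4) * ((?m + 1) * \<tau>)"
    using first_euclid[OF g d0 assms(4)] by blast
  obtain v t2 where v: "algorithm_A \<sigma> cm p g = (v, t2)" "v \<noteq> 0" "\<And>a. a \<odot> g \<in> LI p \<longleftrightarrow> a \<in> LI v"
      "real t2 \<le> (1 + real (degree v)) * I + (4 * real \<delta> + 4 + 8 * real (degree v)) * ((?m + 1) * \<tau>)"
    using second_euclid[OF g p(2,3,4)] by blast
  define e where "e = degree v"
  have e: "1 \<le> e"
  proof (rule ccontr)
    assume "\<not> 1 \<le> e"
    then have "[:1:] \<in> LI v" using v(2) by (intro degree_0_left_principal) (auto simp: e_def)
    then have "g \<odot> d \<in> LI g" using v(3)[of "[:1:]"] p(5) by simp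
    then show False using assms by simp
  qed
  let ?g' = "v \<odot> g"
  have ideal: "LI ?g' = {a \<in> LI g. a \<odot> d \<in> LI g}"
  proof -
    have "a \<in> LI ?g' \<longleftrightarrow> (\<exists>b. a = b \<odot> g \<and> b \<in> LI v)" for a
      unfolding left_principal_def mem_Collect_eq by (metis mult_assoc)
    also have "\<dots> a \<longleftrightarrow> a \<in> LI g \<and> a \<odot> d \<in> LI g" for a
      unfolding v(3)[symmetric] p(5) by (auto simp: left_principal_def)
    finally show ?thesis by auto
  qed
  obtain q \<rho> t0 where q: "left_div \<sigma> cm (g \<odot> d) g = ((q, \<rho>), t0)" by (metis prod.collapse)
  have \<rho>: "\<rho> \<noteq> 0"
    using left_div_remainder_0_iff[OF g, of "g \<odot> d"] assms q by simp
  have d': "ds ! (i - Suc 0) = d" by (simp add: d)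
  have st: "fst (algorithm_B_step \<sigma> cm ds (g, i)) = (?g', 1)"
    "snd (algorithm_B_step \<sigma> cm ds (g, i))
      = snd (poly_mul \<sigma> cm g d) + t0 + t1 + t2 + snd (poly_mul \<sigma> cm v g)"
    using q \<rho> p(1) v(1) by (simp_all add: algorithm_B_step_def left_lcm_def Let_def fst_poly_mul d')
  have len: "real (length (coeffs v)) = real e + 1" "real (length (coeffs g)) = ?m + 1"
    using v(2) g by (auto simp: length_coeffs_degree e_def)
  have "real (snd (poly_mul \<sigma> cm v g)) \<le> (real e + 1) * ((?m + 1) * \<tau>)"
    using snd_poly_mul[of v g] unfolding len .
  then have "real t1 + real t2 + real (snd (poly_mul \<sigma> cm v g))
      \<le> (real \<delta> + 2 + real e) * I + (14 * real \<delta> + 9 + 9 * real e) * ((?m + 1) * \<tau>)"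
    using p(6) v(4) unfolding e_def[symmetric] by (simp add: algebra_simps)
  \<comment> \<open>\<open>e \<ge> 1\<close> turns the part independent of \<open>e\<close> into a
    multiple of \<open>e\<close>, so that the costs of all updates add up through the total degree
    gained.\<close>
  also have "\<dots> \<le> (real e * (real \<delta> + 3)) * I + (real e * (18 * (real \<delta> + 1))) * ((?m + 1) * \<tau>)"
  proof (intro add_mono mult_right_mono)
    have *: "real \<delta> \<le> real e * real \<delta>" using e mult_right_mono[of 1 "real e" "real \<delta>"] by simp
    show "real \<delta> + 2 + real e \<le> real e * (real \<delta> + 3)"
      using * e by (simp add: algebra_simps)
    show "14 * real \<delta> + 9 + 9 * real e \<le> real e * (18 * (real \<delta> + 1))"
      using * e by (simp add: algebra_simps)
  qed (use bounds_nonneg in auto)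
  also have "\<dots> = real e * ((real \<delta> + 3) * I + 18 * (real \<delta> + 1) * (?m + 1) * \<tau>)"
    by (simp add: algebra_simps)
  finally have "real (snd (algorithm_B_step \<sigma> cm ds (g, i)))
        \<le> (I + 3 * (real \<delta> + 1) * (?m + 1) * \<tau>)
          + real e * ((real \<delta> + 3) * I + 18 * (real \<delta> + 1) * (?m + 1) * \<tau>)"
    using check_cost[OF g assms(4)] q st by simp
  then show ?thesis
    using st e ideal g v(2) degree_mult[OF v(2) g]
    by (intro exI[of _ ?g'] exI[of _ e]) (auto simp: e_def)
qed

definition check_weight :: "nat \<Rightarrow> nat \<Rightarrow> real" where
  "check_weight \<delta> m = I + 3 * (real \<delta> + 1) * (real m + 1) * \<tau>"

definition update_weight :: "nat \<Rightarrow> nat \<Rightarrow> real" where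
  "update_weight \<delta> m = (real \<delta> + 3) * I + 18 * (real \<delta> + 1) * (real m + 1) * \<tau>"

lemma check_weight_mono: "m \<le> n \<Longrightarrow> check_weight \<delta> m \<le> check_weight \<delta> n"
  and update_weight_mono: "m \<le> n \<Longrightarrow> update_weight \<delta> m \<le> update_weight \<delta> n"
  using bounds_nonneg unfolding check_weight_def update_weight_def
  by (intro add_left_mono mult_right_mono mult_left_mono; simp)+

lemma weights_nonneg: "0 \<le> check_weight \<delta> m" "0 \<le> update_weight \<delta> m"
  using bounds_nonneg by (simp_all add: check_weight_def update_weight_def)

text \<open>Two-sidedness of RF gives x d in RF for x in RF, so RF survives every update; this caps
  the degree and forces termination. The clause for \<open>ds = []\<close> serves the final
  estimate, whose simplification uses s >= 1.\<close>

lemma algorithm_B_correct: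
  assumes f: "f \<noteq> 0" and F: "F \<noteq> 0" "LI F \<subseteq> LI f"
    and two_sided: "\<And>x y. x \<in> LI F \<Longrightarrow> x \<odot> y \<in> LI F"
    and deg: "\<forall>d\<in>set ds. degree d \<le> \<delta>"
  shows "\<exists>g t. algorithm_B \<sigma> cm ds f = Some (g, t) \<and> g \<noteq> 0 \<and> LI F \<subseteq> LI g \<and> LI g \<subseteq> LI f \<and>
    (\<forall>d\<in>set ds. g \<odot> d \<in> LI g) \<and> (ds = [] \<longrightarrow> t = 0) \<and>
    real t \<le> (real (degree F) - real (degree f) + 1) * real (length ds) * check_weight \<delta> (degree F)
      + (real (degree F) - real (degree f)) * update_weight \<delta> (degree F)"
proof -
  define s where "s = length ds"
  define ck where "ck = check_weight \<delta> (degree F)"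
  define up where "up = update_weight \<delta> (degree F)"
  let ?n = "real (degree f)"
  \<comment> \<open>Each degree gained pays for one update weight and a full round of
    \<open>s\<close> tests; \<open>i - 1\<close> counts the tests since the last update.\<close>
  let ?Inv = "\<lambda>(g, i) t. g \<noteq> 0 \<and> LI F \<subseteq> LI g \<and> LI g \<subseteq> LI f \<and> 1 \<le> i \<and> i \<le> s + 1 \<and>
    (\<forall>j < i - 1. g \<odot> ds ! j \<in> LI g) \<and> (ds = [] \<longrightarrow> t = (0::nat)) \<and>
    real t \<le> ((real (degree g) - ?n) * real s + (real i - 1)) * ck + (real (degree g) - ?n) * up"
  \<comment> \<open>The lexicographic order on (remaining degree, remaining tests), in base
    \<open>s + 1\<close> because an update resets the second component to \<open>s\<close>.\<close>
  let ?m = "\<lambda>(g, i). (degree F - degree g) * (s + 1) + (s + 1 - i)"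
  have "\<exists>y t. counted_while (\<lambda>(g, i). i \<le> s) (algorithm_B_step \<sigma> cm ds) (f, 1) = Some (y, t)
      \<and> ?Inv y t \<and> \<not> (\<lambda>(g, i). i \<le> s) y"
  proof (rule counted_while_rule[where m = ?m])
    show "?Inv (f, 1) 0" using f F by simp
  next
    fix x t assume *: "?Inv x t" "case x of (g, i) \<Rightarrow> i \<le> s"
    obtain g i where x: "x = (g, i)" by (cases x)
    have i: "1 \<le> i" "i \<le> s" and g: "g \<noteq> 0" "LI F \<subseteq> LI g" "LI g \<subseteq> LI f"
      and checked: "\<forall>j < i - 1. g \<odot> ds ! j \<in> LI g"
      and t: "real t \<le> ((real (degree g) - ?n) * real s + (real i - 1)) * ck + (real (degree g) - ?n) * up"
      using * x by auto
    define d where "d = ds ! (i - 1)"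
    have d: "degree d \<le> \<delta>"
      using deg i by (auto simp: d_def s_def)
    have degF: "degree h \<le> degree F" if "LI F \<subseteq> LI h" for h
      using that left_principal_self[of F] degree_left_principal[of F h] F(1) by blast
    have ne: "ds \<noteq> []" using i by (auto simp: s_def)
    show "?Inv (fst (algorithm_B_step \<sigma> cm ds x)) (t + snd (algorithm_B_step \<sigma> cm ds x)) \<and>
      ?m (fst (algorithm_B_step \<sigma> cm ds x)) < ?m x"
    proof (cases "g \<odot> d \<in> LI g")
      case True
      note step = algorithm_B_step_good[OF g(1) True[unfolded d_def] d[unfolded d_def]]
      have "real (snd (algorithm_B_step \<sigma> cm ds x)) \<le> ck"
        using step(2) check_weight_mono[OF degF[OF g(2)], of \<delta>] unfolding x ck_def check_weight_def
        by linarith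
      then have "real (t + snd (algorithm_B_step \<sigma> cm ds x))
          \<le> ((real (degree g) - ?n) * real s + (real (i + 1) - 1)) * ck + (real (degree g) - ?n) * up"
        using t by (simp add: algebra_simps)
      moreover have "\<forall>j < i. g \<odot> ds ! j \<in> LI g"
        using checked True i(1) by (metis One_nat_def Suc_pred d_def less_Suc_eq less_le_trans zero_less_one)
      ultimately show ?thesis
        using step(1) i g ne unfolding x by auto
    next
      case False
      obtain g' e where g': "fst (algorithm_B_step \<sigma> cm ds (g, i)) = (g', 1)" "g' \<noteq> 0" "e \<ge> 1"
        "degree g' = degree g + e" "LI g' = {a \<in> LI g. a \<odot> d \<in> LI g}"
        "real (snd (algorithm_B_step \<sigma> cm ds (g, i)))
          \<le> check_weight \<delta> (degree g) + real e * update_weight \<delta> (degree g)"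
        using algorithm_B_step_bad[OF g(1) d_def False d]
        unfolding check_weight_def update_weight_def by blast
      have sub: "LI F \<subseteq> LI g'" "LI g' \<subseteq> LI f"
        using g'(5) g two_sided by auto
      have "real (snd (algorithm_B_step \<sigma> cm ds x)) \<le> ck + real e * up"
        using g'(6) check_weight_mono[OF degF[OF g(2)], of \<delta>]
          mult_left_mono[OF update_weight_mono[OF degF[OF g(2)], of \<delta>], of "real e"]
        unfolding x ck_def up_def by simp
      then have "real (t + snd (algorithm_B_step \<sigma> cm ds x))
          \<le> ((real (degree g) - ?n) * real s + real i) * ck + (real (degree g') - ?n) * up"
        using t g'(4) by (simp add: algebra_simps)
      also have "\<dots> \<le> ((real (degree g') - ?n) * real s + (real 1 - 1)) * ck + (real (degree g') - ?n) * up"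
      proof (intro add_right_mono mult_right_mono)
        \<comment> \<open>The \<open>i\<close> tests of the finished round, the failing one
          included, are paid by the \<open>e \<ge> 1\<close> degrees gained.\<close>
        have "real i \<le> real e * real s"
          using i g'(3) mult_mono[of 1 "real e" "real i" "real s"] by simp
        then show "(real (degree g) - ?n) * real s + real i \<le> (real (degree g') - ?n) * real s + (real 1 - 1)"
          using g'(4) by (simp add: algebra_simps)
      qed (simp add: ck_def weights_nonneg)
      finally have cost: "real (t + snd (algorithm_B_step \<sigma> cm ds x))
        \<le> ((real (degree g') - ?n) * real s + (real 1 - 1)) * ck + (real (degree g') - ?n) * up" .
      have "degree F - degree g' < degree F - degree g"
        using degF[OF sub(1)] g'(3,4) by simp
      then have "(degree F - degree g' + 1) * (s + 1) \<le> (degree F - degree g) * (s + 1)"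
        by (intro mult_right_mono) auto
      then have "?m (g', 1) < ?m (g, i)"
        using i by simp
      then show ?thesis
        using g'(1,2) sub i ne cost unfolding x by simp
    qed
  qed
  then obtain g i t where res: "counted_while (\<lambda>(g, i). i \<le> s) (algorithm_B_step \<sigma> cm ds) (f, 1) = Some ((g, i), t)"
      "?Inv (g, i) t" "i > s"
    by auto
  have i: "i = s + 1" using res by simp
  have F': "degree g \<le> degree F"
    using res(2) left_principal_self[of F] degree_left_principal[of F g] F(1) by auto
  have "real t \<le> ((real (degree g) - ?n) * real s + real s) * ck + (real (degree g) - ?n) * up"
    using res(2) i by simp
  also have "\<dots> = (real (degree g) - ?n + 1) * real s * ck + (real (degree g) - ?n) * up"
    by (simp add: algebra_simps)
  also have "\<dots> \<le> (real (degree F) - ?n + 1) * real s * ck + (real (degree F) - ?n) * up"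
    using F' by (intro add_mono mult_right_mono) (auto simp: ck_def up_def weights_nonneg)
  finally show ?thesis
    using res i unfolding algorithm_B_def s_def[symmetric] ck_def[symmetric] up_def[symmetric]
    by (intro exI[of _ g] exI[of _ t]) (auto simp: in_set_conv_nth s_def)
qed

end

section \<open>The degree of a bound\<close>

text \<open>Fraction-free Gaussian elimination over the domain Z/P: more unknowns than equations
  leave a solution that is nonzero modulo P. The multiplication is a parameter because the lemma is
  used both with D (and P = 0) and with R, whose product is \<open>skew_mult\<close>.\<close>

lemma prime_elimination:
  fixes m :: "'b::ab_group_add \<Rightarrow> 'b \<Rightarrow> 'b" (infixl "\<star>" 70)
  assumes Z_diff: "\<And>x y. x \<in> Z \<Longrightarrow> y \<in> Z \<Longrightarrow> x - y \<in> Z"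
    and Z_mult: "\<And>x y. x \<in> Z \<Longrightarrow> y \<in> Z \<Longrightarrow> x \<star> y \<in> Z"
    and assoc: "\<And>x y z. x \<star> y \<star> z = x \<star> (y \<star> z)"
    and commute: "\<And>x y. x \<in> Z \<Longrightarrow> y \<in> Z \<Longrightarrow> x \<star> y = y \<star> x"
    and distrib_left: "\<And>x y z. x \<star> (y + z) = x \<star> y + x \<star> z"
    and distrib_right: "\<And>x y z. (x + y) \<star> z = x \<star> z + y \<star> z"
    and P_sub: "P \<subseteq> Z"
    and P_0: "0 \<in> P"
    and P_diff: "\<And>x y. x \<in> P \<Longrightarrow> y \<in> P \<Longrightarrow> x - y \<in> P"
    and P_mult: "\<And>x y. x \<in> Z \<Longrightarrow> y \<in> P \<Longrightarrow> x \<star> y \<in> P"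
    and P_prime: "\<And>x y. x \<in> Z \<Longrightarrow> y \<in> Z \<Longrightarrow> x \<star> y \<in> P \<Longrightarrow> x \<in> P \<or> y \<in> P"
    and P_proper: "P \<noteq> Z"
    and fin: "finite Cols" "finite Rows" "card Cols < card Rows"
    and entries: "\<And>i j. i \<in> Rows \<Longrightarrow> j \<in> Cols \<Longrightarrow> C i j \<in> Z"
  shows "\<exists>x. (\<forall>i\<in>Rows. x i \<in> Z) \<and> (\<exists>i\<in>Rows. x i \<notin> P) \<and>
    (\<forall>j\<in>Cols. (\<Sum>i\<in>Rows. x i \<star> C i j) \<in> P)"
proof -
  have P_add: "x + y \<in> P" if "x \<in> P" "y \<in> P" for x y
    using P_diff[OF that(1) P_diff[OF P_0 that(2)]] by simp
  have P_sum: "sum g A \<in> P" if "\<And>a. a \<in> A \<Longrightarrow> g a \<in> P" for g and A :: "'d set"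
    using that by (induction A rule: infinite_finite_induct) (auto simp: P_0 intro: P_add)
  have mult_0: "x \<star> 0 = 0" "0 \<star> x = 0" for x
    using distrib_left[of x 0 0] distrib_right[of 0 0 x] by simp_all
  have mult_neg: "(- x) \<star> y = - (x \<star> y)" for x y
    using distrib_right[of "- x" x y] mult_0 by (simp add: eq_neg_iff_add_eq_0)
  have mult_neg_right: "x \<star> (- y) = - (x \<star> y)" for x y
    using distrib_left[of x "- y" y] mult_0 by (simp add: eq_neg_iff_add_eq_0)
  have mult_diff_right: "x \<star> (y - z) = x \<star> y - x \<star> z" for x y z
    using distrib_left[of x y "- z"] by (simp add: mult_neg_right)
  have sum_mult: "sum g A \<star> y = (\<Sum>a\<in>A. g a \<star> y)" for g and A :: "'c set" and y
    by (induction A rule: infinite_finite_induct) (auto simp: mult_0 distrib_right)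
  have Z_0: "0 \<in> Z" using P_0 P_sub by auto
  have Z_neg: "- x \<in> Z" if "x \<in> Z" for x using Z_diff[OF Z_0 that] by simp
  have Z_add: "x + y \<in> Z" if "x \<in> Z" "y \<in> Z" for x y
    using Z_diff[OF that(1) Z_neg[OF that(2)]] by simp
  have Z_sum: "sum g A \<in> Z" if "\<And>a. a \<in> A \<Longrightarrow> g a \<in> Z" for g and A :: "'c set"
    using that by (induction A rule: infinite_finite_induct) (auto simp: Z_0 intro: Z_add)
  show ?thesis
    using fin entries
  proof (induction Cols arbitrary: Rows C rule: finite_induct)
    case empty
    then obtain i where "i \<in> Rows" by fastforce
    moreover obtain z where "z \<in> Z" "z \<notin> P" using P_sub P_proper by auto
    ultimately show ?case by (intro exI[of _ "\<lambda>_. z"]) auto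
  next
    case (insert j Cols)
    show ?case
    proof (cases "\<exists>p\<in>Rows. C p j \<notin> P")
      case False
      obtain x where "\<forall>i\<in>Rows. x i \<in> Z" "\<exists>i\<in>Rows. x i \<notin> P"
        "\<forall>j\<in>Cols. (\<Sum>i\<in>Rows. x i \<star> C i j) \<in> P"
        using insert.IH[of Rows C] insert.prems insert.hyps by auto
      moreover from this False have "(\<Sum>i\<in>Rows. x i \<star> C i j) \<in> P"
        by (intro P_sum P_mult) auto
      ultimately show ?thesis by (intro exI[of _ x]) auto
    next
      case True
      then obtain p where p: "p \<in> Rows" "C p j \<notin> P" by auto
      define c where "c = C p j"
      \<comment> \<open>Cross-multiplying with the pivot \<open>c\<close> eliminates column
        \<open>j\<close> without division; commutativity of Z makes this column vanish
        exactly.\<close>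
      define C' where "C' i k = c \<star> C i k - C i j \<star> C p k" for i k
      have "card Cols < card (Rows - {p})"
        using insert.prems insert.hyps p by simp
      moreover have "C' i k \<in> Z" if "i \<in> Rows - {p}" "k \<in> Cols" for i k
        using that p insert.prems(3) unfolding C'_def c_def by (intro Z_diff Z_mult) auto
      ultimately obtain x where x: "\<forall>i\<in>Rows - {p}. x i \<in> Z" "\<exists>i\<in>Rows - {p}. x i \<notin> P"
        "\<forall>k\<in>Cols. (\<Sum>i\<in>Rows - {p}. x i \<star> C' i k) \<in> P"
        using insert.IH[of "Rows - {p}" C'] insert.prems(1) by auto
      \<comment> \<open>Back-substitution: scaling by \<open>c\<close> keeps the solution nontrivial
        modulo the prime P, and the pivot coordinate makes the full system equal to the reduced
        one.\<close>
      define y where "y i = (if i = p then - (\<Sum>l\<in>Rows - {p}. x l \<star> C l j) else x i \<star> c)" for i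
      have cZ: "c \<in> Z" "c \<notin> P" using p insert.prems(3) by (auto simp: c_def)
      have "\<forall>i\<in>Rows. y i \<in> Z"
        using x(1) cZ insert.prems(3) by (auto simp: y_def intro!: Z_neg Z_sum Z_mult)
      moreover have "\<exists>i\<in>Rows. y i \<notin> P"
      proof -
        obtain i where "i \<in> Rows" "i \<noteq> p" "x i \<notin> P" using x(2) by auto
        then show ?thesis using x(1) cZ P_prime[of "x i" c] by (auto simp: y_def)
      qed
      moreover have rel: "(\<Sum>i\<in>Rows. y i \<star> C i k) = (\<Sum>i\<in>Rows - {p}. x i \<star> C' i k)" for k
      proof -
        have "(\<Sum>i\<in>Rows. y i \<star> C i k) = y p \<star> C p k + (\<Sum>i\<in>Rows - {p}. y i \<star> C i k)"
          using p insert.prems(1) by (simp add: sum.remove)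
        also have "y p \<star> C p k = - (\<Sum>i\<in>Rows - {p}. x i \<star> (C i j \<star> C p k))"
          by (simp add: y_def mult_neg sum_mult assoc)
        also have "(\<Sum>i\<in>Rows - {p}. y i \<star> C i k) = (\<Sum>i\<in>Rows - {p}. x i \<star> (c \<star> C i k))"
          by (intro sum.cong) (auto simp: y_def assoc)
        finally show ?thesis
          by (simp add: C'_def mult_diff_right sum_subtractf)
      qed
      moreover have "(\<Sum>i\<in>Rows. y i \<star> C i k) \<in> P" if "k \<in> insert j Cols" for k
      proof (cases "k = j")
        case True
        have "C' i j = 0" if "i \<in> Rows" for i
          using commute[of c "C i j"] cZ that insert.prems(3) by (simp add: C'_def c_def)
        then show ?thesis using rel[of j] True by (simp add: mult_0 P_0)
      next
        case False
        then show ?thesis using rel[of k] x(3) that by simp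
      qed
      ultimately show ?thesis by blast
    qed
  qed
qed

context skew_poly
begin

section \<open>The center and the left ideals of R\<close>

abbreviation Z :: "'a poly set" where "Z \<equiv> center_of (skew_mult \<sigma>)"

lemma center_commute: "z \<in> Z \<Longrightarrow> z \<odot> x = x \<odot> z"
  by (simp add: center_of_def)

lemma center_diff: "x \<in> Z \<Longrightarrow> y \<in> Z \<Longrightarrow> x - y \<in> Z"
  by (simp add: center_of_def)

lemma center_mult: "x \<in> Z \<Longrightarrow> y \<in> Z \<Longrightarrow> x \<odot> y \<in> Z"
  unfolding center_of_def mem_Collect_eq by (metis mult_assoc)

lemma center_one: "[:1:] \<in> Z"
  by (simp add: center_of_def)

text \<open>The free cost model turns the correctness of the algorithms into statements about \<open>R\<close> alone.\<close>

lemma skew_poly_cost_zero: "skew_poly_cost \<sigma>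
    \<lparr>cost_add = \<lambda>_ _. 0, cost_mul = \<lambda>_ _. 0, cost_inv = \<lambda>_. 0, cost_aut = \<lambda>_ _. 0\<rparr> 0 0 0 0"
  by unfold_locales auto

lemma left_division:
  assumes "g \<noteq> 0"
  obtains q \<rho> where "h = q \<odot> g + \<rho>" "\<rho> = 0 \<or> degree \<rho> < degree g"
  using skew_poly_cost.left_div_correct[OF skew_poly_cost_zero assms] by (metis surj_pair)

lemma left_annihilator:
  assumes "f \<noteq> 0"
  obtains v where "v \<noteq> 0" "degree v \<le> degree f" "v \<odot> h \<in> LI f"
proof (cases "h = 0")
  case True
  then show ?thesis using that[of "[:1:]"] left_principal_zero by simp
next
  case False
  then show ?thesis
    using skew_poly_cost.algorithm_A_small[OF skew_poly_cost_zero assms False]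
      skew_poly_cost.algorithm_A_large[OF skew_poly_cost_zero assms, of h] that left_principal_self
    by (metis not_le)
qed

lemma left_ideal_principal:
  assumes sub: "\<And>x y. x \<in> I \<Longrightarrow> y \<in> I \<Longrightarrow> x - y \<in> I" and mult: "\<And>a x. x \<in> I \<Longrightarrow> a \<odot> x \<in> I"
    and nz: "u \<in> I" "u \<noteq> 0"
  obtains g where "g \<noteq> 0" "I = LI g"
proof -
  obtain g where g: "g \<in> I \<and> g \<noteq> 0" "\<And>y. y \<in> I \<and> y \<noteq> 0 \<Longrightarrow> degree g \<le> degree y"
    using ex_has_least_nat[of "\<lambda>g. g \<in> I \<and> g \<noteq> 0" u degree] nz by blast
  have "I \<subseteq> LI g"
  proof
    fix h assume "h \<in> I"
    obtain q \<rho> where q: "h = q \<odot> g + \<rho>" "\<rho> = 0 \<or> degree \<rho> < degree g"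
      using left_division g(1) by metis
    have "\<rho> = h - q \<odot> g" using q by simp
    then have "\<rho> \<in> I" using sub mult g(1) \<open>h \<in> I\<close> by simp
    then have "\<rho> = 0" using g(2) q(2) by (meson not_le)
    then show "h \<in> LI g" using q left_principalI by simp
  qed
  moreover have "LI g \<subseteq> I" using mult g(1) by (auto simp: left_principal_def)
  ultimately show ?thesis using that g(1) by blast
qed

lemma ann_quotient_iff: "a \<in> ann_quotient \<sigma> f \<longleftrightarrow> (\<forall>h. a \<odot> h \<in> LI f)"
  by (simp add: ann_quotient_def)

text \<open>From wR in Rg and uR in Ra follows that uwR lies in uRg, hence in Rag. As degrees add, a
  linear degree bound passes from factors to products.\<close>

lemma ann_quotient_mult:
  assumes "u \<in> ann_quotient \<sigma> a" "w \<in> ann_quotient \<sigma> g"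
  shows "u \<odot> w \<in> ann_quotient \<sigma> (a \<odot> g)"
  unfolding ann_quotient_iff
proof
  fix x
  obtain y where "w \<odot> x = y \<odot> g" using assms(2) by (auto simp: ann_quotient_iff left_principal_def)
  moreover obtain b where "u \<odot> y = b \<odot> a" using assms(1) by (auto simp: ann_quotient_iff left_principal_def)
  ultimately have "u \<odot> w \<odot> x = b \<odot> (a \<odot> g)" by (metis mult_assoc)
  then show "u \<odot> w \<odot> x \<in> LI (a \<odot> g)" by (simp add: left_principalI)
qed

text \<open>In the density theorem such families arise from vectors of the simple module R/Rf that
  are independent over its endomorphism ring, the \<open>e j\<close> sending them to 0 or to the
  coset of 1. Taking the dual pair itself as the notion keeps endomorphisms out.\<close>

definition dual_system :: "'a poly \<Rightarrow> nat \<Rightarrow> (nat \<Rightarrow> 'a poly) \<Rightarrow> (nat \<Rightarrow> 'a poly) \<Rightarrow> bool" where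
  "dual_system f t h e \<longleftrightarrow>
     (\<forall>i<t. \<forall>j<t. e j \<odot> h i - (if i = j then [:1:] else 0) \<in> LI f)"

text \<open>Maximality of the left ideal Rf, in the form in which simplicity of R/Rf is used: every
  nonzero coset can be moved to the coset of 1.\<close>

definition left_maximal :: "'a poly \<Rightarrow> bool" where
  "left_maximal f \<longleftrightarrow> [:1:] \<notin> LI f \<and> (\<forall>h. h \<notin> LI f \<longrightarrow> (\<exists>a. a \<odot> h - [:1:] \<in> LI f))"

lemma left_principal_diff_iff: "x - y \<in> LI f \<Longrightarrow> x \<in> LI f \<longleftrightarrow> y \<in> LI f"
  using left_principal_diff[of x f "x - y"] left_principal_add[of "x - y" f y] by auto

text \<open>Simplicity rescales \<open>b\<close> to an \<open>a\<close> with
  \<open>a \<odot> x\<close> congruent to 1, still killing all \<open>h i\<close>. The old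
  functionals are made to vanish at \<open>x\<close> by subtracting
  \<open>e j \<odot> x \<odot> a\<close>, which does not change their values at the
  \<open>h i\<close> modulo Rf.\<close>

lemma dual_system_extend:
  assumes f: "left_maximal f" and dual: "dual_system f t h e"
    and b: "\<And>i. i < t \<Longrightarrow> b \<odot> h i \<in> LI f" "b \<odot> x \<notin> LI f"
  shows "\<exists>h' e'. dual_system f (Suc t) h' e'"
proof -
  obtain c where c: "c \<odot> (b \<odot> x) - [:1:] \<in> LI f" using f b by (auto simp: left_maximal_def)
  define a where "a = c \<odot> b"
  have ax: "a \<odot> x - [:1:] \<in> LI f" and ah: "\<And>i. i < t \<Longrightarrow> a \<odot> h i \<in> LI f"
    using c b by (auto simp: a_def mult_assoc left_principal_mult)
  define h' where "h' = h(t := x)"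
  define e' where "e' j = (if j = t then a else e j - e j \<odot> x \<odot> a)" for j
  have "e' j \<odot> h' i - (if i = j then [:1:] else 0) \<in> LI f" if ij: "i < Suc t" "j < Suc t" for i j
  proof (cases "j = t")
    case True
    then show ?thesis using ij ax ah by (auto simp: e'_def h'_def)
  next
    case False
    show ?thesis
    proof (cases "i = t")
      case True
      have "e' j \<odot> h' i = (- (e j \<odot> x)) \<odot> (a \<odot> x - [:1:])"
        using True False by (simp add: e'_def h'_def mult_assoc)
      then show ?thesis using left_principal_mult[OF ax] True False by (metis diff_0_right)
    next
      case i: False
      then have "e j \<odot> h i - (if i = j then [:1:] else 0) \<in> LI f" "e j \<odot> x \<odot> (a \<odot> h i) \<in> LI f"
        using dual ij False left_principal_mult[OF ah] unfolding dual_system_def by (metis less_SucE)+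
      then have "(e j \<odot> h i - (if i = j then [:1:] else 0)) - e j \<odot> x \<odot> (a \<odot> h i) \<in> LI f"
        by (rule left_principal_diff)
      moreover have "e' j \<odot> h' i - (if i = j then [:1:] else 0)
          = (e j \<odot> h i - (if i = j then [:1:] else 0)) - e j \<odot> x \<odot> (a \<odot> h i)"
        using False i by (simp add: e'_def h'_def mult_assoc)
      ultimately show ?thesis by (simp only:)
    qed
  qed
  then show ?thesis unfolding dual_system_def by blast
qed

text \<open>The products \<open>h i \<odot> e j\<close> act on \<open>R/Rf\<close> as matrix units, hence are independent over the center
  modulo the prime ideal \<open>Z \<inter> Rf\<close>.\<close>

lemma dual_system_card:
  assumes f: "left_maximal f" and dual: "dual_system f t h e"
    and B: "finite B" "\<And>x. \<exists>c. (\<forall>b\<in>B. c b \<in> Z) \<and> x = (\<Sum>b\<in>B. c b \<odot> b)"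
  shows "t ^ 2 \<le> card B"
proof (rule ccontr)
  assume "\<not> t ^ 2 \<le> card B"
  then have card: "card B < card ({..<t} \<times> {..<t})"
    by (simp add: power2_eq_square)
  define E where "E = (\<lambda>(i, j). h i \<odot> e j)"
  have "\<forall>p. \<exists>c. (\<forall>b\<in>B. c b \<in> Z) \<and> E p = (\<Sum>b\<in>B. c b \<odot> b)"
    using B(2) by blast
  then obtain C where "\<forall>p. (\<forall>b\<in>B. C p b \<in> Z) \<and> E p = (\<Sum>b\<in>B. C p b \<odot> b)"
    unfolding choice_iff by blast
  then have C: "\<And>p b. b \<in> B \<Longrightarrow> C p b \<in> Z" "\<And>p. E p = (\<Sum>b\<in>B. C p b \<odot> b)"
    by auto
  define P where "P = Z \<inter> LI f"
  \<comment> \<open>If a y is congruent to 1 modulo Rf, then x is congruent to x (a y) = a (x y),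
    which lies in Rf; centrality moves x past a.\<close>
  have prime: "x \<in> P \<or> y \<in> P" if xy: "x \<in> Z" "y \<in> Z" "x \<odot> y \<in> P" for x y
  proof (rule ccontr)
    assume *: "\<not> (x \<in> P \<or> y \<in> P)"
    then obtain a where "a \<odot> y - [:1:] \<in> LI f" using f xy by (auto simp: P_def left_maximal_def)
    then have "x \<odot> (a \<odot> y - [:1:]) \<in> LI f" by (rule left_principal_mult)
    moreover have "x \<odot> (a \<odot> y) = a \<odot> (x \<odot> y)"
      using center_commute[OF xy(1), of "a \<odot> y"] center_commute[OF xy(1), of y]
      by (simp add: mult_assoc)
    moreover have "a \<odot> (x \<odot> y) \<in> LI f" using xy left_principal_mult by (simp add: P_def)
    ultimately have "x \<in> LI f" using left_principal_diff_iff[of "a \<odot> (x \<odot> y)" x f] by simp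
    then show False using * xy by (simp add: P_def)
  qed
  \<comment> \<open>The \<open>t^2\<close> products \<open>E p\<close> have coordinates in
    \<open>card B\<close> columns only, so some central combination of them, nontrivial modulo P,
    has all coordinates in P.\<close>
  have "\<exists>x. (\<forall>p\<in>{..<t} \<times> {..<t}. x p \<in> Z) \<and> (\<exists>p\<in>{..<t} \<times> {..<t}. x p \<notin> P) \<and>
      (\<forall>b\<in>B. (\<Sum>p\<in>{..<t} \<times> {..<t}. x p \<odot> C p b) \<in> P)"
  proof (rule prime_elimination[where m = "skew_mult \<sigma>" and Z = Z and P = P and C = C])
    show "P \<noteq> Z" using f center_one by (auto simp: P_def left_maximal_def)
    show "0 \<in> P" by (simp add: P_def left_principal_zero center_of_def)
    show "x - y \<in> P" if "x \<in> P" "y \<in> P" for x y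
      using that by (simp add: P_def left_principal_diff center_diff)
    show "x \<odot> y \<in> P" if "x \<in> Z" "y \<in> P" for x y
      using that by (simp add: P_def left_principal_mult center_mult)
    show "x \<in> P \<or> y \<in> P" if "x \<in> Z" "y \<in> Z" "x \<odot> y \<in> P" for x y
      using prime that .
    show "x \<odot> y = y \<odot> x" if "x \<in> Z" for x y
      using center_commute[OF that] .
    show "C p b \<in> Z" if "b \<in> B" for p b
      using C(1) that .
    show "card B < card ({..<t} \<times> {..<t})" by (fact card)
  qed (use B(1) in \<open>auto simp: P_def mult_assoc center_diff center_mult\<close>)
  then obtain x where "\<forall>p\<in>{..<t} \<times> {..<t}. x p \<in> Z" and x_notin: "\<exists>p\<in>{..<t} \<times> {..<t}. x p \<notin> P"
      and "\<forall>b\<in>B. (\<Sum>p\<in>{..<t} \<times> {..<t}. x p \<odot> C p b) \<in> P"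
    by (elim exE conjE)
  note x = this(1)[rule_format] x_notin this(3)[rule_format]
  define w where "w = (\<Sum>p\<in>{..<t} \<times> {..<t}. x p \<odot> E p)"
  have w_eq: "w = (\<Sum>b\<in>B. (\<Sum>p\<in>{..<t} \<times> {..<t}. x p \<odot> C p b) \<odot> b)"
    unfolding w_def C(2) mult_sum_left mult_sum_right mult_assoc by (rule sum.swap)
  \<comment> \<open>A coordinate z in P is central and in Rf, so z b y = (b y) z stays in Rf:
    \<open>w\<close> annihilates R/Rf.\<close>
  have w: "w \<odot> y \<in> LI f" for y
  proof -
    have "z \<odot> b \<odot> y \<in> LI f" if "z \<in> P" for z b
      using that left_principal_mult[of z f "b \<odot> y"] center_commute[of z "b \<odot> y"]
      by (simp add: P_def mult_assoc)
    then show ?thesis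
      unfolding w_eq mult_sum_left[of _ B] using x(3) by (intro left_principal_sum) blast
  qed
  \<comment> \<open>Shows that e_k (x_ij h_i e_j) h_l differs from x_ij times two Kronecker deltas
    by an element of Rf. \<open>p\<close> and \<open>q\<close> are these deltas; \<open>p\<close> is
    0 or 1 and can therefore change places with the other factors.\<close>
  have expand: "z \<odot> (u \<odot> v \<odot> (a \<odot> b - p) + p \<odot> (u \<odot> v - q)) = u \<odot> (z \<odot> (v \<odot> a) \<odot> b) - z \<odot> (p \<odot> q)"
    if "z \<in> Z" "p = [:1:] \<or> p = 0" for z u v a b p q
  proof -
    have "z \<odot> (u \<odot> c) = u \<odot> (z \<odot> c)" for c
      using center_commute[OF that(1), of u] mult_assoc[of z u c] mult_assoc[of u z c] by simp
    then show ?thesis using that(2) by (auto simp: mult_assoc)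
  qed
  have "x (k, l) \<in> P" if kl: "k < t" "l < t" for k l
  proof -
    \<comment> \<open>Sandwiching the annihilating \<open>w\<close> between \<open>e k\<close> and
      \<open>h l\<close> isolates one coefficient, as with matrix units.\<close>
    have "e k \<odot> (w \<odot> h l) - x (k, l) \<in> LI f"
    proof -
      let ?\<delta> = "\<lambda>i j. if i = j then [:1:] else 0 :: 'a poly"
      have one: "e k \<odot> (x (i, j) \<odot> (h i \<odot> e j) \<odot> h l) - (if i = k \<and> j = l then x (i, j) else 0) \<in> LI f"
        if "i < t" "j < t" for i j
      proof -
        have xz: "x (i, j) \<in> Z" using x(1) that by simp
        have "e j \<odot> h l - ?\<delta> l j \<in> LI f" "e k \<odot> h i - ?\<delta> i k \<in> LI f"
          using dual that kl by (auto simp: dual_system_def)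
        then have "e k \<odot> h i \<odot> (e j \<odot> h l - ?\<delta> l j) + ?\<delta> l j \<odot> (e k \<odot> h i - ?\<delta> i k) \<in> LI f"
          by (intro left_principal_add left_principal_mult)
        then have "x (i, j) \<odot> (e k \<odot> h i \<odot> (e j \<odot> h l - ?\<delta> l j) + ?\<delta> l j \<odot> (e k \<odot> h i - ?\<delta> i k)) \<in> LI f"
          by (rule left_principal_mult)
        moreover have "x (i, j) \<odot> (e k \<odot> h i \<odot> (e j \<odot> h l - ?\<delta> l j) + ?\<delta> l j \<odot> (e k \<odot> h i - ?\<delta> i k))
            = e k \<odot> (x (i, j) \<odot> (h i \<odot> e j) \<odot> h l) - x (i, j) \<odot> (?\<delta> l j \<odot> ?\<delta> i k)"
          by (rule expand) (use xz in auto)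
        moreover have "x (i, j) \<odot> (?\<delta> l j \<odot> ?\<delta> i k) = (if i = k \<and> j = l then x (i, j) else 0)"
          by simp
        ultimately show ?thesis by (simp only:)
      qed
      have "e k \<odot> (w \<odot> h l) = (\<Sum>(i, j)\<in>{..<t} \<times> {..<t}. e k \<odot> (x (i, j) \<odot> (h i \<odot> e j) \<odot> h l))"
        by (simp add: w_def E_def mult_sum_left mult_sum_right split_def)
      moreover have "x (k, l) = (\<Sum>(i, j)\<in>{..<t} \<times> {..<t}. if i = k \<and> j = l then x (i, j) else 0)"
      proof -
        have "(\<Sum>(i, j)\<in>{..<t} \<times> {..<t}. if i = k \<and> j = l then x (i, j) else 0)
          = (\<Sum>p\<in>{..<t} \<times> {..<t}. if p = (k, l) then x p else 0)"
          unfolding split_def by (intro sum.cong refl) (auto simp: prod_eq_iff)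
        then show ?thesis using kl by simp
      qed
      ultimately have "e k \<odot> (w \<odot> h l) - x (k, l) = (\<Sum>(i, j)\<in>{..<t} \<times> {..<t}.
          e k \<odot> (x (i, j) \<odot> (h i \<odot> e j) \<odot> h l) - (if i = k \<and> j = l then x (i, j) else 0))"
        by (simp add: split_def sum_subtractf)
      then show ?thesis using one by (auto intro!: left_principal_sum)
    qed
    then have "x (k, l) \<in> LI f"
      using left_principal_mult[OF w] left_principal_diff_iff by blast
    then show ?thesis using x(1) kl by (simp add: P_def)
  qed
  then show False using x(2) by auto
qed

text \<open>If u kills the first t cosets, Algorithm A supplies a v of degree at most
  \<open>degree f\<close> that kills the coset of u h_t; then v u kills one coset more, and degrees
  add.\<close>

lemma common_annihilator:
  assumes "f \<noteq> 0"
  shows "\<exists>u. u \<noteq> 0 \<and> degree u \<le> t * degree f \<and> (\<forall>i<t. u \<odot> h i \<in> LI f)"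
proof (induction t)
  case 0
  show ?case by (intro exI[of _ "[:1:]"]) simp
next
  case (Suc t)
  then obtain u where u: "u \<noteq> 0" "degree u \<le> t * degree f" "\<forall>i<t. u \<odot> h i \<in> LI f" by blast
  obtain v where v: "v \<noteq> 0" "degree v \<le> degree f" "v \<odot> (u \<odot> h t) \<in> LI f"
    using left_annihilator[OF assms] by blast
  show ?case
    using u v left_principal_mult degree_mult[OF v(1) u(1)]
    by (intro exI[of _ "v \<odot> u"]) (auto simp: less_Suc_eq mult_assoc)
qed

text \<open>Take the largest \<open>t\<close>, which exists because
  \<open>t \<le> t^2 \<le> card B\<close>. A common annihilator of its \<open>h i\<close> kills all
  of R/Rf, since an \<open>x\<close> it misses would extend the system.\<close>

lemma ann_quotient_degree_maximal:
  assumes f: "left_maximal f" "f \<noteq> 0"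
    and B: "finite B" "\<And>x. \<exists>c. (\<forall>b\<in>B. c b \<in> Z) \<and> x = (\<Sum>b\<in>B. c b \<odot> b)"
  shows "\<exists>u\<in>ann_quotient \<sigma> f. u \<noteq> 0 \<and> real (degree u) \<le> sqrt (real (card B)) * real (degree f)"
proof -
  have bound: "t ^ 2 \<le> card B" if "\<exists>h e. dual_system f t h e" for t
    using dual_system_card[OF f(1) _ B] that by blast
  define Q where "Q t \<longleftrightarrow> (\<exists>h e. dual_system f t h e)" for t
  have "t \<le> card B" if "Q t" for t
    using le_trans[OF le_square bound[OF that[unfolded Q_def], unfolded power2_eq_square]] .
  then have "\<forall>t. Q t \<longrightarrow> t < Suc (card B)" by (simp add: less_Suc_eq_le)
  moreover have "Q 0" by (simp add: Q_def dual_system_def)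
  ultimately have "\<exists>t. Q t \<and> (\<forall>t'. Q t' \<longrightarrow> t' \<le> t)"
    using ex_has_greatest_nat[of Q 0 "\<lambda>t. t" "Suc (card B)"] by simp
  then obtain t where t: "Q t" "\<And>t'. Q t' \<Longrightarrow> t' \<le> t" by blast
  obtain h e where he: "dual_system f t h e" using t(1) Q_def by blast
  obtain u where u: "u \<noteq> 0" "degree u \<le> t * degree f" "\<forall>i<t. u \<odot> h i \<in> LI f"
    using common_annihilator[OF f(2)] by blast
  have "u \<odot> x \<in> LI f" for x
  proof (rule ccontr)
    assume "u \<odot> x \<notin> LI f"
    then have "\<exists>h' e'. dual_system f (Suc t) h' e'"
      using dual_system_extend[OF f(1) he] u(3) by blast
    then have "Suc t \<le> t" by (intro t(2)) (simp add: Q_def)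
    then show False by simp
  qed
  moreover have "real (degree u) \<le> sqrt (real (card B)) * real (degree f)"
  proof -
    have "real t \<le> sqrt (real (card B))"
      using bound[OF t(1)[unfolded Q_def]] by (intro real_le_rsqrt) (metis of_nat_le_iff of_nat_power)
    then have "real t * real (degree f) \<le> sqrt (real (card B)) * real (degree f)"
      by (intro mult_right_mono) auto
    then show ?thesis using u(2) by (metis of_nat_le_iff of_nat_mult order_trans)
  qed
  ultimately show ?thesis using u(1) by (auto simp: ann_quotient_iff)
qed

text \<open>A proper Rf that is not maximal lies strictly inside a proper left ideal Rg, so f = a g
  with both factors of positive degree, and annihilators of R/Ra and R/Rg multiply.\<close>

lemma ann_quotient_degree:
  assumes "f \<noteq> 0"
    and B: "finite B" "\<And>x. \<exists>c. (\<forall>b\<in>B. c b \<in> Z) \<and> x = (\<Sum>b\<in>B. c b \<odot> b)"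
  shows "\<exists>u\<in>ann_quotient \<sigma> f. u \<noteq> 0 \<and> real (degree u) \<le> sqrt (real (card B)) * real (degree f)"
  using assms(1)
proof (induction "degree f" arbitrary: f rule: less_induct)
  case less
  show ?case
  proof (cases "[:1:] \<in> LI f")
    case True
    then have "[:1:] \<in> ann_quotient \<sigma> f"
      unfolding ann_quotient_iff by (metis left_principal_mult mult_one one_mult)
    then show ?thesis by (intro bexI[of _ "[:1:]"]) auto
  next
    case proper: False
    show ?thesis
    proof (cases "left_maximal f")
      case True
      then show ?thesis using ann_quotient_degree_maximal[OF _ less.prems B] by blast
    next
      case False
      then obtain h where h: "h \<notin> LI f" "\<And>a. a \<odot> h - [:1:] \<notin> LI f"
        using proper by (auto simp: left_maximal_def)
      define J where "J = {a \<odot> h + b \<odot> f | a b. True}"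
      have fJ: "f \<in> J" and hJ: "h \<in> J"
        unfolding J_def by (force intro: exI[of _ 0] exI[of _ "[:1:]"])+
      obtain g where g: "g \<noteq> 0" "J = LI g"
      proof (rule left_ideal_principal[of J f])
        fix x y assume "x \<in> J" "y \<in> J"
        then obtain a b c d where "x = a \<odot> h + b \<odot> f" "y = c \<odot> h + d \<odot> f" unfolding J_def by blast
        then have "x - y = (a - c) \<odot> h + (b - d) \<odot> f" by simp
        then show "x - y \<in> J" unfolding J_def by blast
      next
        fix a x assume "x \<in> J"
        then obtain c d where "x = c \<odot> h + d \<odot> f" unfolding J_def by blast
        then have "a \<odot> x = (a \<odot> c) \<odot> h + (a \<odot> d) \<odot> f" by (simp add: mult_assoc)
        then show "a \<odot> x \<in> J" unfolding J_def by blast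
      qed (use fJ less.prems in auto)
      obtain a where a: "f = a \<odot> g" using fJ g by (auto simp: left_principal_def)
      have a0: "a \<noteq> 0" using a less.prems by auto
      have deg: "degree f = degree a + degree g" using a degree_mult[OF a0 g(1)] by simp
      \<comment> \<open>\<open>J\<close> is proper because no left multiple of \<open>h\<close> is
        congruent to 1 modulo Rf.\<close>
      have "degree g \<noteq> 0"
      proof
        assume "degree g = 0"
        then have "[:1:] \<in> J"
          using skew_poly_cost.degree_0_left_principal[OF skew_poly_cost_zero g(1)] g(2) by simp
        then obtain c d where "[:1:] = c \<odot> h + d \<odot> f" unfolding J_def by blast
        then have "c \<odot> h - [:1:] = (- d) \<odot> f" by simp
        then show False using h(2) left_principalI by metis
      qed
      moreover have "degree a \<noteq> 0"
      proof
        assume "degree a = 0"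
        then have "[:1:] \<in> LI a"
          using skew_poly_cost.degree_0_left_principal[OF skew_poly_cost_zero a0] by simp
        then obtain c where "[:1:] = c \<odot> a" by (auto simp: left_principal_def)
        then have "g = c \<odot> f" using a by (metis mult_assoc one_mult)
        then have "LI g \<subseteq> LI f" using left_principalI left_principal_subset by simp
        then show False using h(1) hJ g(2) by auto
      qed
      ultimately have lt: "degree a < degree f" "degree g < degree f" using deg by auto
      obtain u where u: "u \<in> ann_quotient \<sigma> a" "u \<noteq> 0"
          "real (degree u) \<le> sqrt (real (card B)) * real (degree a)"
        using less.hyps[OF lt(1) a0] by blast
      obtain w where w: "w \<in> ann_quotient \<sigma> g" "w \<noteq> 0"
          "real (degree w) \<le> sqrt (real (card B)) * real (degree g)"
        using less.hyps[OF lt(2) g(1)] by blast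
      have "real (degree (u \<odot> w)) \<le> sqrt (real (card B)) * real (degree f)"
        using u w degree_mult[OF u(2) w(2)] deg by (simp add: algebra_simps)
      then show ?thesis
        using ann_quotient_mult[OF u(1) w(1)] u(2) w(2) a by (intro bexI[of _ "u \<odot> w"]) auto
    qed
  qed
qed

end

section \<open>The skew polynomial ring over its center\<close>

definition lin_span :: "'a::division_ring set \<Rightarrow> 'a set \<Rightarrow> 'a set" where
  "lin_span K B = {x. \<exists>c. (\<forall>b\<in>B. c b \<in> K) \<and> x = (\<Sum>b\<in>B. c b * b)}"

locale division_subring =
  fixes K :: "'a::division_ring set"
  assumes K_one: "1 \<in> K" and K_diff: "x \<in> K \<Longrightarrow> y \<in> K \<Longrightarrow> x - y \<in> K"
    and K_mult: "x \<in> K \<Longrightarrow> y \<in> K \<Longrightarrow> x * y \<in> K" and K_inverse: "x \<in> K \<Longrightarrow> inverse x \<in> K"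
begin

lemma K_zero: "0 \<in> K"
  using K_diff[OF K_one K_one] by simp

lemma K_minus: "x \<in> K \<Longrightarrow> - x \<in> K"
  using K_diff[OF K_zero] by simp

lemma K_add: "x \<in> K \<Longrightarrow> y \<in> K \<Longrightarrow> x + y \<in> K"
  using K_diff[OF _ K_minus] by simp

lemma lin_spanI: "(\<And>b. b \<in> B \<Longrightarrow> c b \<in> K) \<Longrightarrow> (\<Sum>b\<in>B. c b * b) \<in> lin_span K B"
  by (auto simp: lin_span_def)

lemma lin_span_base:
  assumes "finite B" "b \<in> B" "k \<in> K"
  shows "k * b \<in> lin_span K B"
proof -
  have "(\<Sum>a\<in>B. (if a = b then k else 0) * a) \<in> lin_span K B"
    using assms K_zero by (intro lin_spanI) auto
  moreover have "(\<Sum>a\<in>B. (if a = b then k else 0) * a) = (\<Sum>a\<in>B. if a = b then k * b else 0)"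
    by (intro sum.cong) auto
  ultimately show ?thesis using assms by simp
qed

lemma lin_span_zero: "0 \<in> lin_span K B"
  using lin_spanI[of B "\<lambda>_. 0"] K_zero by simp

lemma lin_span_add:
  assumes "x \<in> lin_span K B" "y \<in> lin_span K B"
  shows "x + y \<in> lin_span K B"
proof -
  obtain c d where "\<forall>b\<in>B. c b \<in> K" "\<forall>b\<in>B. d b \<in> K" "x = (\<Sum>b\<in>B. c b * b)" "y = (\<Sum>b\<in>B. d b * b)"
    using assms by (auto simp: lin_span_def)
  then have "x + y = (\<Sum>b\<in>B. (c b + d b) * b)" "\<forall>b\<in>B. c b + d b \<in> K"
    by (auto simp: sum.distrib algebra_simps K_add)
  then show ?thesis by (auto simp: lin_span_def)
qed

lemma lin_span_sum: "(\<And>a. a \<in> A \<Longrightarrow> g a \<in> lin_span K B) \<Longrightarrow> sum g A \<in> lin_span K B"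
  by (induction A rule: infinite_finite_induct) (auto intro: lin_span_zero lin_span_add)

lemma relation_solve:
  assumes "finite B" "b0 \<in> B" "d b0 \<noteq> 0" "\<And>b. b \<in> B \<Longrightarrow> d b \<in> K" "(\<Sum>b\<in>B. d b * b) = 0"
  shows "b0 \<in> lin_span K (B - {b0})"
proof -
  have "d b0 * b0 + (\<Sum>b\<in>B - {b0}. d b * b) = 0"
    using assms by (simp add: sum.remove)
  then have "d b0 * b0 = - (\<Sum>b\<in>B - {b0}. d b * b)"
    by (simp add: eq_neg_iff_add_eq_0)
  then have "inverse (d b0) * (d b0 * b0) = inverse (d b0) * (- (\<Sum>b\<in>B - {b0}. d b * b))"
    by simp
  also have "\<dots> = (\<Sum>b\<in>B - {b0}. (- (inverse (d b0) * d b)) * b)"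
    by (simp add: sum_distrib_left sum_negf mult.assoc)
  finally have "b0 = (\<Sum>b\<in>B - {b0}. (- (inverse (d b0) * d b)) * b)"
    using assms(3) by (simp flip: mult.assoc)
  also have "\<dots> \<in> lin_span K (B - {b0})"
    using assms by (intro lin_spanI K_minus K_mult K_inverse) auto
  finally show ?thesis .
qed

lemma lin_span_scale:
  assumes "k \<in> K" "x \<in> lin_span K B"
  shows "k * x \<in> lin_span K B"
proof -
  obtain c where c: "\<forall>b\<in>B. c b \<in> K" "x = (\<Sum>b\<in>B. c b * b)" using assms(2) by (auto simp: lin_span_def)
  have "k * x = (\<Sum>b\<in>B. (k * c b) * b)" by (simp add: c(2) sum_distrib_left mult.assoc)
  also have "\<dots> \<in> lin_span K B" using assms(1) c(1) by (intro lin_spanI K_mult) auto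
  finally show ?thesis .
qed

lemma lin_span_remove:
  assumes "finite B" "b0 \<in> lin_span K (B - {b0})"
  shows "lin_span K B \<subseteq> lin_span K (B - {b0})"
proof
  fix x assume "x \<in> lin_span K B"
  then obtain c where c: "\<forall>b\<in>B. c b \<in> K" "x = (\<Sum>b\<in>B. c b * b)" by (auto simp: lin_span_def)
  have "c b * b \<in> lin_span K (B - {b0})" if "b \<in> B" for b
    using c that assms lin_span_base[of "B - {b0}" b] lin_span_scale by (cases "b = b0") auto
  then show "x \<in> lin_span K (B - {b0})" unfolding c(2) by (rule lin_span_sum)
qed

text \<open>A spanning set of least size is independent: a relation would express one element by the
  others, which would then span.\<close>

lemma finite_span_imp_free_basis:
  assumes "finite G" "lin_span K G = UNIV"
  shows "\<exists>B. free_basis (*) K B"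
proof -
  obtain B where B: "finite B \<and> lin_span K B = UNIV"
    "\<And>B'. finite B' \<and> lin_span K B' = UNIV \<Longrightarrow> card B \<le> card B'"
    using ex_has_least_nat[of "\<lambda>B. finite B \<and> lin_span K B = UNIV" G card] assms by blast
  have indep: "d b = 0" if d: "\<And>b. b \<in> B \<Longrightarrow> d b \<in> K" "(\<Sum>b\<in>B. d b * b) = 0" "b \<in> B" for d b
  proof (rule ccontr)
    assume "d b \<noteq> 0"
    then have "b \<in> lin_span K (B - {b})" using relation_solve[of B b d] B(1) d by blast
    then have "lin_span K (B - {b}) = UNIV" using lin_span_remove[of B b] B(1) by auto
    then have "card B \<le> card (B - {b})" using B by simp
    then show False using B(1) d(3) by (metis card_Diff1_less not_le)
  qed
  have "\<exists>!c. (\<forall>b. b \<in> B \<longrightarrow> c b \<in> K) \<and> (\<forall>b. b \<notin> B \<longrightarrow> c b = 0) \<and> x = (\<Sum>b\<in>B. c b * b)" for x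
  proof -
    have "x \<in> lin_span K B" using B(1) by simp
    then obtain c where c: "\<forall>b\<in>B. c b \<in> K" "x = (\<Sum>b\<in>B. c b * b)" by (auto simp: lin_span_def)
    show ?thesis
    proof (rule ex1I[of _ "\<lambda>b. if b \<in> B then c b else 0"])
      show "(\<forall>b. b \<in> B \<longrightarrow> (if b \<in> B then c b else 0) \<in> K) \<and>
          (\<forall>b. b \<notin> B \<longrightarrow> (if b \<in> B then c b else 0) = 0) \<and>
          x = (\<Sum>b\<in>B. (if b \<in> B then c b else 0) * b)"
        using c by auto
    next
      fix c' assume c': "(\<forall>b. b \<in> B \<longrightarrow> c' b \<in> K) \<and> (\<forall>b. b \<notin> B \<longrightarrow> c' b = 0) \<and> x = (\<Sum>b\<in>B. c' b * b)"
      have "(\<Sum>b\<in>B. (c' b - c b) * b) = 0"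
        using c(2) c' by (simp add: left_diff_distrib sum_subtractf)
      moreover have "c' b - c b \<in> K" if "b \<in> B" for b
        using c(1) c' that K_diff by blast
      ultimately have "c' b - c b = 0" if "b \<in> B" for b
        using indep[of "\<lambda>b. c' b - c b" b] that by blast
      then show "c' = (\<lambda>b. if b \<in> B then c b else 0)" using c' by auto
    qed
  qed
  then show ?thesis using B(1) by (auto simp: free_basis_def)
qed

end

section \<open>Finite dimension of D over K\<close>

locale skew_poly_finite = skew_poly \<sigma> for \<sigma> :: "'a::division_ring \<Rightarrow> 'a" +
  fixes N :: nat
  assumes N_pos: "0 < N" and order: "\<sigma> ^^ N = id"
    and finite_dim: "\<exists>B. free_basis (*) (center_of ((*) :: 'a \<Rightarrow> 'a \<Rightarrow> 'a)) B"
begin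

abbreviation C :: "'a set" where "C \<equiv> center_of (*)"
definition K :: "'a set" where "K = C \<inter> {a. \<sigma> a = a}"

lemma C_commute: "c \<in> C \<Longrightarrow> c * x = x * c"
  by (simp add: center_of_def)

lemma aut_simps [simp]: "\<sigma> (x + y) = \<sigma> x + \<sigma> y" "\<sigma> (x * y) = \<sigma> x * \<sigma> y" "\<sigma> 1 = 1" "\<sigma> 0 = 0"
    "\<sigma> (- x) = - \<sigma> x" "\<sigma> (x - y) = \<sigma> x - \<sigma> y" "\<sigma> x = 0 \<longleftrightarrow> x = 0"
  using aut_add[of 1] aut_mult[of 1] aut_one[of 1] aut_zero[of 1] aut_minus[of 1] aut_diff[of 1]
    aut_eq_0_iff[of 1] by simp_all

lemma aut_inverse: "\<sigma> (inverse x) = inverse (\<sigma> x)"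
proof (cases "x = 0")
  case False
  then have "\<sigma> (inverse x) * \<sigma> x = 1" by (simp flip: aut_simps(2))
  then show ?thesis by (metis inverse_unique inverse_inverse_eq)
qed simp

lemma C_aut: "c \<in> C \<Longrightarrow> \<sigma> c \<in> C"
proof -
  assume c: "c \<in> C"
  have "\<sigma> c * x = x * \<sigma> c" for x
  proof -
    obtain y where "x = \<sigma> y" using aut unfolding ring_automorphism_def by (metis bij_pointE)
    then show ?thesis using C_commute[OF c, of y] by (simp flip: aut_simps(2))
  qed
  then show ?thesis by (simp add: center_of_def)
qed

lemma C_aut_pow: "c \<in> C \<Longrightarrow> (\<sigma> ^^ i) c \<in> C"
  by (induction i) (auto intro: C_aut)

sublocale C: division_subring C
proof
  show "inverse x \<in> C" if "x \<in> C" for x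
  proof (cases "x = 0")
    case False
    have "inverse x * y = y * inverse x" for y
    proof -
      have "inverse x * (x * y) * inverse x = inverse x * (y * x) * inverse x"
        using C_commute[OF that, of y] by simp
      then show ?thesis using False by (simp add: mult.assoc flip: mult.assoc[of "inverse x" x])
    qed
    then show ?thesis by (simp add: center_of_def)
  qed (use that in simp)
  show "1 \<in> C" by (simp add: center_of_def)
  show "x - y \<in> C" if "x \<in> C" "y \<in> C" for x y
    using that by (simp add: center_of_def left_diff_distrib right_diff_distrib)
  show "x * y \<in> C" if "x \<in> C" "y \<in> C" for x y
    using that unfolding center_of_def mem_Collect_eq by (metis mult.assoc)
qed

sublocale K: division_subring K
  by unfold_locales (auto simp: K_def C.K_one C.K_diff C.K_mult C.K_inverse aut_inverse)

lemma aut_pow_period: "(\<sigma> ^^ (i + N)) a = (\<sigma> ^^ i) a"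
  by (simp add: funpow_add order)

text \<open>A solution of minimal support of the equations \<open>\<Sum> x\<^sub>a \<sigma>\<^sup>i(a) = 0\<close> with a coordinate equal
  to 1 is fixed by \<open>\<sigma>\<close>, since otherwise \<open>\<sigma>(x) - x\<close> would have smaller support.\<close>

lemma artin_dependence:
  assumes A: "finite A" "A \<subseteq> C" "N < card A"
  shows "\<exists>x. (\<forall>a\<in>A. x a \<in> K) \<and> (\<exists>a\<in>A. x a \<noteq> 0) \<and> (\<Sum>a\<in>A. x a * a) = 0"
proof -
  define Sol where "Sol x \<longleftrightarrow> (\<forall>a\<in>A. x a \<in> C) \<and> (\<forall>i. (\<Sum>a\<in>A. x a * (\<sigma> ^^ i) a) = 0)" for x
  define supp where "supp x = {a \<in> A. x a \<noteq> 0}" for x :: "'a \<Rightarrow> 'a"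
  have "\<exists>x. (\<forall>a\<in>A. x a \<in> C) \<and> (\<exists>a\<in>A. x a \<notin> {0}) \<and>
      (\<forall>i\<in>{..<N}. (\<Sum>a\<in>A. x a * (\<sigma> ^^ i) a) \<in> {0})"
  proof (rule prime_elimination[where m = "(*)" and Z = C and P = "{0}" and C = "\<lambda>a i. (\<sigma> ^^ i) a"])
    show "{0} \<noteq> C" using C.K_one by (metis singletonD zero_neq_one)
    show "x * y = y * x" if "x \<in> C" for x y using C_commute[OF that] .
    show "(\<sigma> ^^ i) a \<in> C" if "a \<in> A" for a i using that A C_aut_pow by blast
  qed (use A C.K_zero C.K_diff C.K_mult in \<open>auto simp: algebra_simps\<close>)
  then obtain x0 where x0: "\<forall>a\<in>A. x0 a \<in> C" "\<exists>a\<in>A. x0 a \<noteq> 0"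
      "\<And>i. i < N \<Longrightarrow> (\<Sum>a\<in>A. x0 a * (\<sigma> ^^ i) a) = 0"
    by auto
  \<comment> \<open>Elimination handles the \<open>N\<close> equations with i < N; periodicity gives
    the rest, and the full system is stable under \<sigma>.\<close>
  have "(\<Sum>a\<in>A. x0 a * (\<sigma> ^^ i) a) = 0" for i
    using x0(3)[of "i mod N"] N_pos order by (simp add: funpow_mod_eq)
  then have "Sol x0 \<and> supp x0 \<noteq> {}" using x0 by (auto simp: Sol_def supp_def)
  then obtain x where x: "Sol x \<and> supp x \<noteq> {}"
      "\<And>y. Sol y \<and> supp y \<noteq> {} \<Longrightarrow> card (supp x) \<le> card (supp y)"
    using ex_has_least_nat[of "\<lambda>x. Sol x \<and> supp x \<noteq> {}" x0 "\<lambda>x. card (supp x)"] by blast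
  obtain j where j: "j \<in> A" "x j \<noteq> 0" using x by (auto simp: supp_def)
  define y where "y a = inverse (x j) * x a" for a
  have y: "Sol y"
  proof -
    have "(\<Sum>a\<in>A. y a * (\<sigma> ^^ i) a) = inverse (x j) * (\<Sum>a\<in>A. x a * (\<sigma> ^^ i) a)" for i
      by (simp add: y_def sum_distrib_left mult.assoc)
    then show ?thesis using x(1) j C.K_inverse C.K_mult by (auto simp: Sol_def y_def)
  qed
  define z where "z a = \<sigma> (y a) - y a" for a
  have z: "Sol z"
  proof -
    have "(\<Sum>a\<in>A. \<sigma> (y a) * (\<sigma> ^^ i) a) = 0" for i
    proof -
      \<comment> \<open>Shifting by \<open>N\<close> first makes the exponent positive, so that one
        \<sigma> can be pulled out of the sum.\<close>
      have "(\<Sum>a\<in>A. \<sigma> (y a) * (\<sigma> ^^ i) a) = (\<Sum>a\<in>A. \<sigma> (y a) * (\<sigma> ^^ (i + N)) a)"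
        by (simp add: aut_pow_period)
      also have "i + N = Suc (i + N - 1)" using N_pos by simp
      also have "(\<Sum>a\<in>A. \<sigma> (y a) * (\<sigma> ^^ Suc (i + N - 1)) a) = \<sigma> (\<Sum>a\<in>A. y a * (\<sigma> ^^ (i + N - 1)) a)"
        using aut_sum[of 1 "\<lambda>a. y a * (\<sigma> ^^ (i + N - 1)) a" A] by simp
      also have "\<dots> = 0" using y by (simp add: Sol_def)
      finally show ?thesis .
    qed
    then show ?thesis using y C_aut C.K_diff
      by (auto simp: Sol_def z_def left_diff_distrib sum_subtractf)
  qed
  have "supp z \<subset> supp x"
  proof -
    have "supp z \<subseteq> supp x" by (auto simp: supp_def z_def y_def)
    moreover have "y j = 1" using j by (simp add: y_def)
    then have "j \<in> supp x" "j \<notin> supp z" using j by (auto simp: supp_def z_def)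
    ultimately show ?thesis by blast
  qed
  then have "card (supp z) < card (supp x)"
    using A(1) by (intro psubset_card_mono) (auto simp: supp_def)
  then have "supp z = {}" using x(2) z by (metis not_le)
  then have "\<forall>a\<in>A. \<sigma> (y a) = y a" by (auto simp: supp_def z_def)
  then have "\<forall>a\<in>A. y a \<in> K" using y by (auto simp: Sol_def K_def)
  moreover have "y j \<noteq> 0" using j by (simp add: y_def)
  moreover have "(\<Sum>a\<in>A. y a * (\<sigma> ^^ 0) a) = 0" using y unfolding Sol_def by blast
  ultimately show ?thesis using j by auto
qed

text \<open>\<open>artin_dependence\<close> bounds the size of K-independent subsets of C by
  \<open>N\<close>; a largest one spans C.\<close>

lemma center_finite_span: "\<exists>A. finite A \<and> C \<subseteq> lin_span K A"
proof -
  define Q where "Q n \<longleftrightarrow> (\<exists>A. finite A \<and> A \<subseteq> C \<and> card A = n \<and>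
    (\<forall>x. (\<forall>a\<in>A. x a \<in> K) \<and> (\<Sum>a\<in>A. x a * a) = 0 \<longrightarrow> (\<forall>a\<in>A. x a = 0)))" for n
  have "\<not> N < n" if "Q n" for n
    using that artin_dependence unfolding Q_def by metis
  then have "\<forall>n. Q n \<longrightarrow> n < Suc N" by (auto simp: less_Suc_eq_le not_less)
  moreover have "Q 0" unfolding Q_def by (intro exI[of _ "{}"]) simp
  ultimately obtain n where n: "Q n" "\<And>m. Q m \<Longrightarrow> m \<le> n"
    using ex_has_greatest_nat[of Q 0 "\<lambda>n. n" "Suc N"] by blast
  then obtain A where A: "finite A" "A \<subseteq> C" "card A = n"
    "\<And>x. (\<forall>a\<in>A. x a \<in> K) \<and> (\<Sum>a\<in>A. x a * a) = 0 \<Longrightarrow> (\<forall>a\<in>A. x a = 0)"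
    unfolding Q_def by blast
  have "c \<in> lin_span K A" if c: "c \<in> C" for c
  proof (cases "c \<in> A")
    case True
    then show ?thesis using K.lin_span_base[OF A(1) True K.K_one] by simp
  next
    case False
    then have "card (insert c A) = Suc n" using A by simp
    then have "\<not> Q (card (insert c A))" using n(2) by fastforce
    have "\<not> (\<forall>x. (\<forall>a\<in>insert c A. x a \<in> K) \<and> (\<Sum>a\<in>insert c A. x a * a) = 0 \<longrightarrow>
        (\<forall>a\<in>insert c A. x a = 0))" (is "\<not> ?indep")
    proof
      assume ?indep
      moreover have "finite (insert c A)" "insert c A \<subseteq> C" using A(1,2) c by auto
      ultimately have "Q (card (insert c A))" unfolding Q_def by blast
      then show False using \<open>\<not> Q (card (insert c A))\<close> by contradiction
    qed
    then obtain x where x: "\<forall>a\<in>insert c A. x a \<in> K" "(\<Sum>a\<in>insert c A. x a * a) = 0"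
        "\<exists>a\<in>insert c A. x a \<noteq> 0"
      by (elim not_all[THEN iffD1, THEN exE]) (metis (no_types, lifting))
    have "x c \<noteq> 0"
    proof
      assume "x c = 0"
      then have "(\<Sum>a\<in>A. x a * a) = 0" using x(2) A(1) False by simp
      then show False using A(4)[of x] x \<open>x c = 0\<close> by auto
    qed
    then have "c \<in> lin_span K (insert c A - {c})"
      using K.relation_solve[of "insert c A" c x] A(1) x by blast
    then show ?thesis using False by simp
  qed
  then show ?thesis using A(1) by blast
qed

text \<open>Tower D over C over K: products of two spanning families span, and
  \<open>finite_span_imp_free_basis\<close> extracts a basis.\<close>

lemma free_basis_K: "\<exists>B. free_basis (*) K B"
proof -
  obtain B where B: "free_basis (*) C B" using finite_dim by blast
  obtain A where A: "finite A" "C \<subseteq> lin_span K A" using center_finite_span by blast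
  let ?G = "(\<lambda>(a, b). a * b) ` (A \<times> B)"
  have finG: "finite ?G" using A B by (simp add: free_basis_def)
  have "x \<in> lin_span K ?G" for x
  proof -
    obtain c where c: "\<forall>b. b \<in> B \<longrightarrow> c b \<in> C" "x = (\<Sum>b\<in>B. c b * b)"
      using B unfolding free_basis_def by metis
    have "c b * b \<in> lin_span K ?G" if b: "b \<in> B" for b
    proof -
      obtain k where k: "\<forall>a\<in>A. k a \<in> K" "c b = (\<Sum>a\<in>A. k a * a)"
        using c b A(2) by (auto simp: lin_span_def)
      have "c b * b = (\<Sum>a\<in>A. k a * (a * b))" by (simp add: k sum_distrib_right mult.assoc)
      also have "\<dots> \<in> lin_span K ?G"
        using k b by (intro K.lin_span_sum K.lin_span_base finG) auto
      finally show ?thesis .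
    qed
    then show ?thesis unfolding c(2) by (rule K.lin_span_sum)
  qed
  then show ?thesis using K.finite_span_imp_free_basis[OF finG] by blast
qed

text \<open>The condition that a X^i is central in R: the first part is commutation with X, the
  second with constants.\<close>

definition central_monom :: "nat \<Rightarrow> 'a \<Rightarrow> bool" where
  "central_monom i a \<longleftrightarrow> \<sigma> a = a \<and> (\<forall>d. d * a = a * (\<sigma> ^^ i) d)"

lemma central_monom_zero: "central_monom i 0"
  by (simp add: central_monom_def)

lemma central_monom_0_iff: "central_monom 0 a \<longleftrightarrow> a \<in> K"
  by (auto simp: central_monom_def K_def center_of_def)

lemma central_monom_mult:
  assumes "central_monom i a" "central_monom j b"
  shows "central_monom (i + j) (a * b)"
proof -
  have "d * (a * b) = a * b * (\<sigma> ^^ (i + j)) d" for d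
  proof -
    have "d * (a * b) = a * ((\<sigma> ^^ i) d * b)"
      using assms(1) by (simp add: central_monom_def flip: mult.assoc)
    also have "(\<sigma> ^^ i) d * b = b * (\<sigma> ^^ (i + j)) d"
      using assms(2) by (simp add: central_monom_def add.commute[of i] funpow_add)
    finally show ?thesis by (simp add: mult.assoc)
  qed
  moreover have "\<sigma> a = a" "\<sigma> b = b" using assms unfolding central_monom_def by blast+
  then have "\<sigma> (a * b) = a * b" by simp
  ultimately show ?thesis unfolding central_monom_def by blast
qed

lemma central_monom_divide:
  assumes a: "central_monom (i + j) a" and b: "central_monom j b" "b \<noteq> 0"
  shows "central_monom i (a * inverse b)"
proof -
  have "d * (a * inverse b) = a * inverse b * (\<sigma> ^^ i) d" for d
  proof -
    have "(\<sigma> ^^ i) d * b = b * (\<sigma> ^^ (i + j)) d"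
      using b(1) by (simp add: central_monom_def add.commute[of i] funpow_add)
    then have "inverse b * ((\<sigma> ^^ i) d * b) * inverse b = inverse b * (b * (\<sigma> ^^ (i + j)) d) * inverse b"
      by simp
    then have "inverse b * (\<sigma> ^^ i) d = (\<sigma> ^^ (i + j)) d * inverse b"
      using b(2) by (simp add: mult.assoc flip: mult.assoc[of "inverse b" b])
    moreover have "d * a = a * (\<sigma> ^^ (i + j)) d" using a unfolding central_monom_def by blast
    ultimately show ?thesis by (simp add: mult.assoc flip: mult.assoc[of d a])
  qed
  moreover have "\<sigma> a = a" "\<sigma> b = b" using a b unfolding central_monom_def by blast+
  then have "\<sigma> (a * inverse b) = a * inverse b" by (simp add: aut_inverse)
  ultimately show ?thesis unfolding central_monom_def by blast
qed

text \<open>Commutation with X and with constants can be tested coefficient by coefficient, so the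
  center is graded: it is spanned by the central monomials.\<close>

lemma center_iff: "z \<in> Z \<longleftrightarrow> (\<forall>i. central_monom i (coeff z i))"
proof
  assume z: "z \<in> Z"
  show "\<forall>i. central_monom i (coeff z i)"
  proof
    fix i
    have "coeff (z \<odot> monom 1 1) (Suc i) = coeff (monom 1 1 \<odot> z) (Suc i)"
      using center_commute[OF z] by simp
    then have "\<sigma> (coeff z i) = coeff z i" by (simp add: coeff_mult_monom coeff_monom_mult)
    moreover have "d * coeff z i = coeff z i * (\<sigma> ^^ i) d" for d
      using arg_cong[OF center_commute[OF z, of "monom d 0"], of "\<lambda>p. coeff p i"]
      by (simp add: coeff_mult_monom coeff_monom_mult)
    ultimately show "central_monom i (coeff z i)" by (simp add: central_monom_def)
  qed
next
  assume central_monom: "\<forall>i. central_monom i (coeff z i)"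
  have fixed: "(\<sigma> ^^ j) (coeff z i) = coeff z i" for i j
    using central_monom by (induction j) (auto simp: central_monom_def)
  have "z \<odot> monom d j = monom d j \<odot> z" for d j
    using central_monom by (auto simp: poly_eq_iff coeff_mult_monom coeff_monom_mult central_monom_def fixed)
  then have "z \<odot> x = x \<odot> z" for x
    by (induction x rule: poly_additive_induct) auto
  then show "z \<in> Z" by (simp add: center_of_def)
qed

text \<open>Let k be the least positive degree of a central monomial. Nonzero central monomials
  occur only in degrees divisible by k, and those of degree k j are the K-multiples of one W_j X^(k
  j). So for a K-basis B of D, the b X^i with i < k form a basis of R over Z: the residue of a
  degree modulo k selects i, and B accounts for the coefficient.\<close>

lemma free_basis_center: "\<exists>B. free_basis (skew_mult \<sigma>) Z B"
proof -
  define k where "k = (LEAST k. 0 < k \<and> (\<exists>w. w \<noteq> 0 \<and> central_monom k w))"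
  have "central_monom N 1" using order by (simp add: central_monom_def)
  then have ex: "\<exists>k. 0 < k \<and> (\<exists>w. w \<noteq> 0 \<and> central_monom k w)" using N_pos zero_neq_one by metis
  have k: "0 < k" "\<exists>w. w \<noteq> 0 \<and> central_monom k w" using LeastI_ex[OF ex] by (auto simp: k_def)
  have least: "i = 0" if "i < k" "central_monom i w" "w \<noteq> 0" for i w
    using not_less_Least[of i "\<lambda>k. 0 < k \<and> (\<exists>w. w \<noteq> 0 \<and> central_monom k w)"] that by (auto simp: k_def)
  have "\<exists>w. w \<noteq> 0 \<and> central_monom (k * j) w" for j
  proof (induction j)
    case 0
    show ?case using K.K_one by (auto simp: central_monom_0_iff intro!: exI[of _ 1])
  next
    case (Suc j)
    then obtain w where "w \<noteq> 0" "central_monom (k * j) w" by blast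
    moreover obtain w0 where "w0 \<noteq> 0" "central_monom k w0" using k by blast
    ultimately show ?case using central_monom_mult[of k w0 "k * j" w] by (intro exI[of _ "w0 * w"]) auto
  qed
  then obtain W where W: "\<And>j. W j \<noteq> 0" "\<And>j. central_monom (k * j) (W j)" by metis
  \<comment> \<open>Dividing out W_(l div k) leaves a nonzero central monomial of degree
    \<open>l mod k\<close>, so this degree is 0 by minimality.\<close>
  have central_monom_dvd: "k dvd l" if "central_monom l a" "a \<noteq> 0" for l a
  proof -
    have "central_monom (l mod k) (a * inverse (W (l div k)))"
      using central_monom_divide[of "l mod k" "k * (l div k)" a] that W by simp
    then have "l mod k = 0" using least[of "l mod k"] k that W by auto
    then show ?thesis by auto
  qed
  have homK: "a * inverse (W j) \<in> K" if "central_monom (k * j) a" for a j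
    using central_monom_divide[of 0 "k * j" a "W j"] that W central_monom_0_iff by simp
  have Khom: "central_monom (k * j) (a * W j)" if "a \<in> K" for a j
    using central_monom_mult[of 0 a "k * j" "W j"] that W central_monom_0_iff by simp

  obtain B where B: "free_basis (*) K B" using free_basis_K by blast
  have finB: "finite B" using B by (simp add: free_basis_def)
  have "\<forall>x. \<exists>c. (\<forall>b. b \<in> B \<longrightarrow> c b \<in> K) \<and> (\<forall>b. b \<notin> B \<longrightarrow> c b = 0) \<and> x = (\<Sum>b\<in>B. c b * b)"
    using B unfolding free_basis_def by blast
  then obtain co where co: "\<And>x b. b \<in> B \<Longrightarrow> co x b \<in> K" "\<And>x. x = (\<Sum>b\<in>B. co x b * b)"
    unfolding choice_iff by blast
  have uniq: "c b = d b" if c: "\<And>b. b \<in> B \<Longrightarrow> c b \<in> K" and d: "\<And>b. b \<in> B \<Longrightarrow> d b \<in> K"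
    and eq: "(\<Sum>b\<in>B. c b * b) = (\<Sum>b\<in>B. d b * b)" and b: "b \<in> B" for c d b
  proof -
    let ?r = "\<lambda>c b. if b \<in> B then c b else 0"
    have "?r c = ?r d"
    proof (rule ex1E[of "\<lambda>e. (\<forall>b. b \<in> B \<longrightarrow> e b \<in> K) \<and> (\<forall>b. b \<notin> B \<longrightarrow> e b = 0) \<and>
        (\<Sum>b\<in>B. c b * b) = (\<Sum>b\<in>B. e b * b)"])
      show "\<exists>!e. (\<forall>b. b \<in> B \<longrightarrow> e b \<in> K) \<and> (\<forall>b. b \<notin> B \<longrightarrow> e b = 0) \<and>
        (\<Sum>b\<in>B. c b * b) = (\<Sum>b\<in>B. e b * b)"
        using B unfolding free_basis_def by blast
    next
      fix e assume *: "\<forall>y. (\<forall>b. b \<in> B \<longrightarrow> y b \<in> K) \<and> (\<forall>b. b \<notin> B \<longrightarrow> y b = 0) \<and>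
        (\<Sum>b\<in>B. c b * b) = (\<Sum>b\<in>B. y b * b) \<longrightarrow> y = e"
      have "?r c = e" using c by (intro *[rule_format]) auto
      moreover have "?r d = e" using d eq by (intro *[rule_format]) auto
      ultimately show ?thesis by simp
    qed
    then show ?thesis using b by (metis (full_types))
  qed
  have co_zero: "co 0 b = 0" if "b \<in> B" for b
    using uniq[of "co 0" "\<lambda>_. 0" b] co(1) co(2)[of 0] that K.K_zero by simp
  have B0: "b \<noteq> 0" if "b \<in> B" for b
  proof
    assume "b = 0"
    have "(\<Sum>a\<in>B. (if a = b then 1 else 0) * a) = (\<Sum>a\<in>B. 0 * a)"
      using \<open>b = 0\<close> by (intro sum.cong) auto
    then have "(if b = b then 1 else 0 :: 'a) = 0"
      using that K.K_zero K.K_one by (intro uniq[of "\<lambda>a. if a = b then 1 else 0" "\<lambda>_. 0" b]) auto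
    then show False by simp
  qed

  define RB where "RB = (\<lambda>(b, i). monom b i) ` (B \<times> {..<k})"
  have inj: "inj_on (\<lambda>(b, i). monom b i) (B \<times> {..<k})"
    using B0 by (auto simp: inj_on_def monom_eq_iff')
  have finRB: "finite RB" using finB by (simp add: RB_def)
  have sum_RB: "(\<Sum>q\<in>RB. c q \<odot> q) = (\<Sum>b\<in>B. \<Sum>i<k. c (monom b i) \<odot> monom b i)" for c
    unfolding RB_def by (subst sum.reindex[OF inj]) (simp add: sum.cartesian_product split_def)
  \<comment> \<open>Only \<open>i = i0\<close> contributes, as the coefficients of central elements
    live in degrees divisible by k. There the coefficient is q W_j with q in K, and moving W_j to
    the right of \<open>b\<close> undoes the twist by \<sigma>^(k j); what remains is a
    K-combination of B times W_j.\<close>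
  have coeff_combination: "coeff (\<Sum>b\<in>B. \<Sum>i<k. z b i \<odot> monom b i) (k * j + i0)
      = (\<Sum>b\<in>B. (coeff (z b i0) (k * j) * inverse (W j)) * b) * W j"
    if z: "\<And>b i. b \<in> B \<Longrightarrow> i < k \<Longrightarrow> z b i \<in> Z" and i0: "i0 < k" for z j i0
  proof -
    have "coeff (z b i \<odot> monom b i) (k * j + i0)
        = (if i = i0 then (coeff (z b i0) (k * j) * inverse (W j)) * b * W j else 0)"
      if b: "b \<in> B" and i: "i < k" for b i
    proof (cases "i = i0")
      case True
      have "b * W j = W j * (\<sigma> ^^ (k * j)) b" using W(2) by (simp add: central_monom_def)
      then have "inverse (W j) * (b * W j) = (\<sigma> ^^ (k * j)) b"
        using W(1) by (simp flip: mult.assoc)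
      then show ?thesis using True by (simp add: coeff_mult_monom mult.assoc)
    next
      case False
      have "coeff (z b i) (k * j + i0 - i) = 0" if le: "i \<le> k * j + i0"
      proof (rule ccontr)
        assume "coeff (z b i) (k * j + i0 - i) \<noteq> 0"
        moreover have "central_monom (k * j + i0 - i) (coeff (z b i) (k * j + i0 - i))"
          using z[OF b i] center_iff by blast
        ultimately have "k dvd k * j + i0 - i" using central_monom_dvd by blast
        then have "(k * j + i0) mod k = i mod k"
          using le by (metis mod_eq_dvd_iff_nat)
        then show False using False i i0 by simp
      qed
      then show ?thesis using False by (simp add: coeff_mult_monom)
    qed
    then have "coeff (\<Sum>b\<in>B. \<Sum>i<k. z b i \<odot> monom b i) (k * j + i0)
        = (\<Sum>b\<in>B. \<Sum>i<k. if i = i0 then (coeff (z b i0) (k * j) * inverse (W j)) * b * W j else 0)"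
      by (simp add: coeff_sum)
    then show ?thesis using i0 by (simp add: sum_distrib_right)
  qed
  have "\<exists>!c. (\<forall>q. q \<in> RB \<longrightarrow> c q \<in> Z) \<and> (\<forall>q. q \<notin> RB \<longrightarrow> c q = 0) \<and> p = (\<Sum>q\<in>RB. c q \<odot> q)" for p
  proof (rule ex_ex1I)
    \<comment> \<open>The upper limit suffices because k >= 1: every \<open>j\<close> with
      \<open>k * j + i \<le> degree p\<close> is at most \<open>degree p\<close>.\<close>
    define z where "z b i = (\<Sum>j\<le>degree p. monom (co (coeff p (k * j + i) * inverse (W j)) b * W j) (k * j))" for b i
    have coeff_z: "coeff (z b i) (k * j) = co (coeff p (k * j + i) * inverse (W j)) b * W j"
      if b: "b \<in> B" for b i j
    proof -
      have "coeff (z b i) (k * j)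
        = (\<Sum>j'\<le>degree p. if j' = j then co (coeff p (k * j + i) * inverse (W j)) b * W j else 0)"
        unfolding z_def coeff_sum using k by (intro sum.cong) auto
      moreover have "co (coeff p (k * j + i) * inverse (W j)) b = 0" if "\<not> j \<le> degree p"
      proof -
        have "j \<le> k * j" using k by simp
        then have "coeff p (k * j + i) = 0" using that by (intro coeff_eq_0) linarith
        then show ?thesis using co_zero[OF b] by simp
      qed
      ultimately show ?thesis by auto
    qed
    have zZ: "z b i \<in> Z" if b: "b \<in> B" for b i
      unfolding center_iff
    proof
      fix l
      show "central_monom l (coeff (z b i) l)"
      proof (cases "k dvd l")
        case True
        then obtain j where "l = k * j" by blast
        then show ?thesis using coeff_z[OF b, of i j] Khom co(1)[OF b] by simp
      next
        case False
        then have "coeff (z b i) l = 0" by (auto simp: z_def coeff_sum intro!: sum.neutral)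
        then show ?thesis by (simp add: central_monom_zero)
      qed
    qed
    \<comment> \<open>\<open>lead_coeff\<close> and \<open>degree\<close> recover the pair (b, i)
      from the monomial; this uses that 0 is not in B.\<close>
    define c where "c q = (if q \<in> RB then z (lead_coeff q) (degree q) else 0)" for q
    have c_monom: "c (monom b i) = z b i" if "b \<in> B" "i < k" for b i
      using that B0 by (auto simp: c_def RB_def degree_monom_eq)
    have "coeff p n = coeff (\<Sum>q\<in>RB. c q \<odot> q) n" for n
    proof -
      have n: "k * (n div k) + n mod k = n" "n mod k < k" using k by auto
      have "(\<Sum>q\<in>RB. c q \<odot> q) = (\<Sum>b\<in>B. \<Sum>i<k. z b i \<odot> monom b i)"
        unfolding sum_RB using c_monom by (intro sum.cong) auto
      then have "coeff (\<Sum>q\<in>RB. c q \<odot> q) n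
          = (\<Sum>b\<in>B. (coeff (z b (n mod k)) (k * (n div k)) * inverse (W (n div k))) * b) * W (n div k)"
        using coeff_combination[of z "n mod k" "n div k"] zZ n by simp
      also have "(\<Sum>b\<in>B. (coeff (z b (n mod k)) (k * (n div k)) * inverse (W (n div k))) * b)
          = (\<Sum>b\<in>B. co (coeff p n * inverse (W (n div k))) b * b)"
        using W(1) by (intro sum.cong) (auto simp: coeff_z mult.assoc)
      also have "\<dots> = coeff p n * inverse (W (n div k))" using co(2) by simp
      finally show ?thesis using W(1) by (simp add: mult.assoc)
    qed
    then have "p = (\<Sum>q\<in>RB. c q \<odot> q)" by (simp add: poly_eq_iff)
    moreover have "\<forall>q. q \<in> RB \<longrightarrow> c q \<in> Z" using zZ c_monom by (auto simp: RB_def)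
    ultimately show "\<exists>c. (\<forall>q. q \<in> RB \<longrightarrow> c q \<in> Z) \<and> (\<forall>q. q \<notin> RB \<longrightarrow> c q = 0) \<and> p = (\<Sum>q\<in>RB. c q \<odot> q)"
      by (intro exI[of _ c]) (auto simp: c_def)
  next
    fix c d
    assume c: "(\<forall>q. q \<in> RB \<longrightarrow> c q \<in> Z) \<and> (\<forall>q. q \<notin> RB \<longrightarrow> c q = 0) \<and> p = (\<Sum>q\<in>RB. c q \<odot> q)"
      and d: "(\<forall>q. q \<in> RB \<longrightarrow> d q \<in> Z) \<and> (\<forall>q. q \<notin> RB \<longrightarrow> d q = 0) \<and> p = (\<Sum>q\<in>RB. d q \<odot> q)"
    have RB: "monom b i \<in> RB" if "b \<in> B" "i < k" for b i using that by (auto simp: RB_def)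
    have "c (monom b i) = d (monom b i)" if b: "b \<in> B" and i: "i < k" for b i
    proof (rule poly_eqI)
      fix l
      show "coeff (c (monom b i)) l = coeff (d (monom b i)) l"
      proof (cases "k dvd l")
        case False
        have "central_monom l (coeff (c (monom b i)) l)" "central_monom l (coeff (d (monom b i)) l)"
          using c d RB[OF b i] center_iff by blast+
        then show ?thesis using False central_monom_dvd by metis
      next
        case True
        then obtain j where l: "l = k * j" by blast
        have "coeff p (k * j + i) = (\<Sum>b\<in>B. (coeff (e (monom b i)) (k * j) * inverse (W j)) * b) * W j"
          if "(\<forall>q. q \<in> RB \<longrightarrow> e q \<in> Z) \<and> (\<forall>q. q \<notin> RB \<longrightarrow> e q = 0) \<and> p = (\<Sum>q\<in>RB. e q \<odot> q)" for e
          using coeff_combination[of "\<lambda>b i. e (monom b i)" i j] that RB i unfolding sum_RB by auto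
        from this[OF c] this[OF d]
        have "(\<Sum>b\<in>B. (coeff (c (monom b i)) (k * j) * inverse (W j)) * b)
            = (\<Sum>b\<in>B. (coeff (d (monom b i)) (k * j) * inverse (W j)) * b)"
          using W(1)[of j] by simp
        moreover have "coeff (e (monom b i)) (k * j) * inverse (W j) \<in> K"
          if "\<forall>q. q \<in> RB \<longrightarrow> e q \<in> Z" "b \<in> B" for e b
          using that RB[of b i] i center_iff by (intro homK) blast
        ultimately have "coeff (c (monom b i)) (k * j) * inverse (W j) = coeff (d (monom b i)) (k * j) * inverse (W j)"
          using c d b by (intro uniq[of "\<lambda>b. coeff (c (monom b i)) (k * j) * inverse (W j)"
            "\<lambda>b. coeff (d (monom b i)) (k * j) * inverse (W j)" b]) auto
        then show ?thesis using W(1)[of j] l by simp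
      qed
    qed
    then have "c q = d q" if "q \<in> RB" for q using that by (auto simp: RB_def)
    then show "c = d" using c d by (metis ext)
  qed
  then show ?thesis using finRB by (auto simp: free_basis_def)
qed

end

section \<open>The complexity of computing a bound\<close>

context skew_poly
begin

lemma ann_quotient_generator:
  assumes "u \<in> ann_quotient \<sigma> f" "u \<noteq> 0"
  obtains F where "F \<noteq> 0" "ann_quotient \<sigma> f = LI F"
proof (rule left_ideal_principal[of "ann_quotient \<sigma> f" u])
  show "x - y \<in> ann_quotient \<sigma> f" if "x \<in> ann_quotient \<sigma> f" "y \<in> ann_quotient \<sigma> f" for x y
    using that by (simp add: ann_quotient_iff left_principal_diff)
  show "a \<odot> x \<in> ann_quotient \<sigma> f" if "x \<in> ann_quotient \<sigma> f" for a x
    using that by (simp add: ann_quotient_iff mult_assoc left_principal_mult)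
qed (use assms that in blast)+

text \<open>Division on the other side works because \<sigma> is onto. The leading term of
  \<open>h\<close> is removed by a right multiple of \<open>g\<close>, which lies in Rg by
  two-sidedness, so the difference stays in Rg and the descent ends at 0.\<close>

lemma right_principal_eq:
  assumes "g \<noteq> 0" and two_sided: "\<And>x. g \<odot> x \<in> LI g"
  shows "right_principal \<sigma> g = LI g"
proof
  show "right_principal \<sigma> g \<subseteq> LI g" using two_sided by (auto simp: right_principal_def)
  have "\<exists>q. h = g \<odot> q" if "h \<in> LI g" for h
    using that
  proof (induction "degree h" arbitrary: h rule: less_induct)
    case less
    show ?case
    proof (cases "h = 0")
      case True
      then show ?thesis by (intro exI[of _ 0]) simp
    next
      case False
      then have le: "degree g \<le> degree h" using degree_left_principal less.prems by blast
      define k where "k = degree h - degree g"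
      obtain c where c: "(\<sigma> ^^ degree g) c = inverse (lead_coeff g) * lead_coeff h"
        using bij_aut[of "degree g"] by (metis bij_pointE)
      define h' where "h' = h - g \<odot> monom c k"
      have "coeff h' (degree h) = 0"
        using assms(1) le by (simp add: h'_def coeff_mult_monom k_def c flip: mult.assoc)
      moreover have "degree h' \<le> degree h"
        using degree_mult_le[of g "monom c k"] degree_monom_le[of c k] le
        unfolding h'_def k_def by (intro degree_diff_le) auto
      ultimately have "h' = 0 \<or> degree h' < degree h"
        by (metis le_neq_implies_less leading_coeff_0_iff)
      moreover have "h' \<in> LI g"
        unfolding h'_def using less.prems two_sided by (intro left_principal_diff)
      ultimately obtain q where "h' = g \<odot> q"
        using less.hyps[of h'] mult_zero_right[of g] by metis
      then have "h = g \<odot> (q + monom c k)" by (simp add: h'_def algebra_simps)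
      then show ?thesis by blast
    qed
  qed
  then show "LI g \<subseteq> right_principal \<sigma> g" by (auto simp: right_principal_def)
qed

text \<open>The x with g x in Rg form a subring, the idealizer of Rg. It contains the center, hence
  everything once it contains the generators; so finitely many tests suffice.\<close>

lemma generators_two_sided:
  assumes "generates_over (skew_mult \<sigma>) Z G" and "\<And>d. d \<in> G \<Longrightarrow> g \<odot> d \<in> LI g"
  shows "g \<odot> x \<in> LI g"
proof -
  let ?T = "{x. g \<odot> x \<in> LI g}"
  have "(\<lambda>T. \<forall>x\<in>T. \<forall>y\<in>T. x - y \<in> T \<and> x \<odot> y \<in> T) hull (Z \<union> G) \<subseteq> ?T"
  proof (rule hull_minimal)
    have "g \<odot> z \<in> LI g" if "z \<in> Z" for z
      using center_commute[OF that, of g] left_principalI[of z g] by simp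
    then show "Z \<union> G \<subseteq> ?T" using assms(2) by auto
    have "g \<odot> (x \<odot> y) \<in> LI g" if x: "g \<odot> x \<in> LI g" and y: "g \<odot> y \<in> LI g" for x y
    proof -
      obtain a where "g \<odot> x = a \<odot> g" using x by (auto simp: left_principal_def)
      then have "g \<odot> (x \<odot> y) = a \<odot> (g \<odot> y)" by (metis mult_assoc)
      then show ?thesis using left_principal_mult[OF y] by simp
    qed
    then show "\<forall>x\<in>?T. \<forall>y\<in>?T. x - y \<in> ?T \<and> x \<odot> y \<in> ?T"
      using left_principal_diff by auto
  qed
  then show ?thesis using assms(1) by (auto simp: generates_over_def)
qed

text \<open>Ann(R/Rf) contains every two-sided ideal inside Rf, in particular Rg.\<close>

lemma is_boundI:
  assumes "g \<noteq> 0" "ann_quotient \<sigma> f \<subseteq> LI g" "LI g \<subseteq> LI f" and two_sided: "\<And>x. g \<odot> x \<in> LI g"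
  shows "is_bound \<sigma> f g"
proof -
  have "LI g \<subseteq> ann_quotient \<sigma> f"
  proof
    fix a assume "a \<in> LI g"
    then obtain b where "a = b \<odot> g" by (auto simp: left_principal_def)
    then have "a \<odot> h \<in> LI g" for h
      using left_principal_mult[OF two_sided, of b h] by (simp add: mult_assoc)
    then show "a \<in> ann_quotient \<sigma> f" using assms(3) by (auto simp: ann_quotient_iff)
  qed
  then have "LI g = ann_quotient \<sigma> f" using assms(2) by auto
  then show ?thesis using right_principal_eq[OF assms(1) two_sided] by (simp add: is_bound_def)
qed

end

text \<open>To be read with N = sqrt r * n, d the degree of a generator of Ann(R/Rf), and P = M + A,
  so that \<tau> = S + P. The factors 6 and 36 in the proof come from d + 1 <= 2 N, and n >= 1 gives
  d - n + 1 <= N.\<close>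

lemma total_cost_bound:
  fixes I S P t s n d N \<delta> :: real
  assumes nonneg: "0 \<le> I" "0 \<le> S" "0 \<le> P" "0 \<le> \<delta>" and s: "1 \<le> s" and n: "1 \<le> n" "n \<le> d" "d \<le> N"
    and t: "t \<le> (d - n + 1) * s * (I + 3 * (\<delta> + 1) * (d + 1) * (S + P))
      + (d - n) * ((\<delta> + 3) * I + 18 * (\<delta> + 1) * (d + 1) * (S + P))"
    and cheap: "S \<le> P \<or> s \<le> N"
  shows "t \<le> 10000 * (\<delta> + 1) ^ 4 * (s * N * I + N ^ 3 * S + s * N\<^sup>2 * P)"
proof -
  have N: "1 \<le> N" using n by linarith
  define U where "U = (\<delta> + 1) * (S + P)"
  have U: "0 \<le> U" using nonneg by (simp add: U_def)
  have "(d + 1) * U \<le> 2 * N * U" using n N U by (intro mult_right_mono) auto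
  then have ck: "I + 3 * (\<delta> + 1) * (d + 1) * (S + P) \<le> I + 6 * N * U"
    and up: "(\<delta> + 3) * I + 18 * (\<delta> + 1) * (d + 1) * (S + P) \<le> (\<delta> + 3) * I + 36 * N * U"
    by (simp_all add: U_def algebra_simps)
  have "(d - n + 1) * s * (I + 3 * (\<delta> + 1) * (d + 1) * (S + P)) \<le> (N * s) * (I + 6 * N * U)"
  proof (intro mult_mono ck)
    show "0 \<le> I + 3 * (\<delta> + 1) * (d + 1) * (S + P)"
      using nonneg n by (intro add_nonneg_nonneg mult_nonneg_nonneg) auto
  qed (use n N s in auto)
  moreover have "(d - n) * ((\<delta> + 3) * I + 18 * (\<delta> + 1) * (d + 1) * (S + P))
      \<le> (N * s) * ((\<delta> + 3) * I + 36 * N * U)"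
  proof (intro mult_mono up)
    have "N * 1 \<le> N * s" using N s by (intro mult_left_mono) auto
    then show "d - n \<le> N * s" using n by linarith
    show "0 \<le> (\<delta> + 3) * I + 18 * (\<delta> + 1) * (d + 1) * (S + P)"
      using nonneg n by (intro add_nonneg_nonneg mult_nonneg_nonneg) auto
  qed (use n N s in auto)
  ultimately have "t \<le> (N * s) * (I + 6 * N * U) + (N * s) * ((\<delta> + 3) * I + 36 * N * U)"
    using t by linarith
  also have "\<dots> = (\<delta> + 4) * (s * N * I) + 42 * (\<delta> + 1) * (s * N\<^sup>2 * S + s * N\<^sup>2 * P)"
    by (simp add: U_def algebra_simps power2_eq_square)
  \<comment> \<open>The additions of the tests have no counterpart in the target;
    \<open>cheap\<close> moves them into the term with P or into the term N^3 S.\<close>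
  also have "s * N\<^sup>2 * S \<le> N ^ 3 * S + s * N\<^sup>2 * P"
    using cheap
  proof
    assume "S \<le> P"
    then have "s * N\<^sup>2 * S \<le> s * N\<^sup>2 * P" using s by (intro mult_left_mono) auto
    moreover have "0 \<le> N ^ 3 * S" using nonneg N by simp
    ultimately show ?thesis by simp
  next
    assume "s \<le> N"
    then have "s * (N\<^sup>2 * S) \<le> N * (N\<^sup>2 * S)" using nonneg by (intro mult_right_mono) auto
    moreover have "0 \<le> s * N\<^sup>2 * P" using nonneg s by simp
    ultimately show ?thesis by (simp add: power3_eq_cube power2_eq_square mult.assoc)
  qed
  finally have "t \<le> (\<delta> + 4) * (s * N * I) + 42 * (\<delta> + 1) * (N ^ 3 * S + s * N\<^sup>2 * P + s * N\<^sup>2 * P)"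
    using nonneg by (simp add: mult_left_mono)
  also have "\<dots> = (\<delta> + 4) * (s * N * I) + (42 * (\<delta> + 1)) * (N ^ 3 * S) + (84 * (\<delta> + 1)) * (s * N\<^sup>2 * P)"
    by (simp add: algebra_simps)
  \<comment> \<open>The three coefficients are at most 84 (\<delta> + 1), far below the implied
    constant.\<close>
  also have "\<dots> \<le> (10000 * (\<delta> + 1) ^ 4) * (s * N * I) + (10000 * (\<delta> + 1) ^ 4) * (N ^ 3 * S)
      + (10000 * (\<delta> + 1) ^ 4) * (s * N\<^sup>2 * P)"
  proof -
    have "\<delta> + 1 \<le> (\<delta> + 1) ^ 4"
      using nonneg power_increasing[of 1 4 "\<delta> + 1"] by simp
    then show ?thesis using nonneg s N by (intro add_mono mult_right_mono) auto
  qed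
  finally show ?thesis by (simp add: distrib_left)
qed

theorem theorem3p6:
  fixes \<sigma> :: "'a::division_ring \<Rightarrow> 'a"
    and K :: "'a set"
    and ds :: "'a poly list"
    and f :: "'a poly"
    and cm :: "'a op_cost"
    and S M I A :: "nat \<Rightarrow> real"
    and \<mu> r s n \<delta> :: nat
  assumes D_finite_dim: "\<exists>B. free_basis (*) (center_of ((*) :: 'a \<Rightarrow> 'a \<Rightarrow> 'a)) B"
    and aut: "ring_automorphism \<sigma>"
    and finite_order: "\<exists>k>0. \<sigma> ^^ k = id"
    and K_eq: "K = center_of (*) \<inter> {a. \<sigma> a = a}"
    and mu_eq: "\<mu> = free_rank (*) K"
    and r_eq: "r = free_rank (skew_mult \<sigma>) (center_of (skew_mult \<sigma>))"
    and generators: "generates_over (skew_mult \<sigma>) (center_of (skew_mult \<sigma>)) (set ds)"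
    and s_eq: "s = length ds"
    and generator_degrees: "\<forall>d\<in>set ds. degree d \<le> \<delta>"
    and f_nonzero: "f \<noteq> 0"
    and n_eq: "n = degree f"
    and add_bound: "\<forall>a b. real (cost_add cm a b) \<le> S \<mu>"
    and mul_bound: "\<forall>a b. real (cost_mul cm a b) \<le> M \<mu>"
    and inv_bound: "\<forall>a. a \<noteq> 0 \<longrightarrow> real (cost_inv cm a) \<le> I \<mu>"
    and aut_bound: "\<forall>i a. real (cost_aut cm i a) \<le> A \<mu>"
  shows "\<exists>g t. algorithm_B \<sigma> cm ds f = Some (g, t) \<and> is_bound \<sigma> f g \<and>
    (n \<ge> 1 \<and> (S \<mu> \<le> M \<mu> \<or> real s \<le> sqrt (real r) * real n) \<longrightarrow>
      real t \<le> implied_constant \<delta> *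
        (sqrt (real r) * real s * real n * I \<mu>
         + real r * sqrt (real r) * real n ^ 3 * S \<mu>
         + real s * real r * real n ^ 2 * (M \<mu> + A \<mu>)))"
proof -
  obtain k where k: "k > 0" "\<sigma> ^^ k = id" using finite_order by blast
  interpret skew_poly_finite \<sigma> k
    using aut k D_finite_dim by unfold_locales
  interpret skew_poly_cost \<sigma> cm "S \<mu>" "M \<mu>" "I \<mu>" "A \<mu>"
    using add_bound mul_bound inv_bound aut_bound by unfold_locales auto
  \<comment> \<open>The very basis that \<open>free_rank\<close> selects, so that its size is
    \<open>r\<close>.\<close>
  define B where "B = (SOME B. free_basis (skew_mult \<sigma>) Z B)"
  have B: "free_basis (skew_mult \<sigma>) Z B"
    unfolding B_def by (rule someI_ex[OF free_basis_center])
  have r: "r = card B" by (simp add: r_eq free_rank_def B_def)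
  have "\<exists>c. (\<forall>b\<in>B. c b \<in> Z) \<and> x = (\<Sum>b\<in>B. c b \<odot> b)" for x
    using B unfolding free_basis_def by metis
  then obtain u where u: "u \<in> ann_quotient \<sigma> f" "u \<noteq> 0" "real (degree u) \<le> sqrt (real r) * real n"
    using ann_quotient_degree[OF f_nonzero, of B] B unfolding r n_eq free_basis_def by metis
  obtain F where F: "F \<noteq> 0" "ann_quotient \<sigma> f = LI F"
    using ann_quotient_generator u by blast
  have F_sub: "LI F \<subseteq> LI f"
    unfolding F(2)[symmetric] ann_quotient_iff[abs_def] using mult_one by (metis ann_quotient_iff subsetI)
  have F_two_sided: "x \<odot> y \<in> LI F" if "x \<in> LI F" for x y
    using that unfolding F(2)[symmetric] ann_quotient_iff by (simp add: mult_assoc)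
  obtain g t where g: "algorithm_B \<sigma> cm ds f = Some (g, t)" "g \<noteq> 0" "LI F \<subseteq> LI g" "LI g \<subseteq> LI f"
      "\<forall>d\<in>set ds. g \<odot> d \<in> LI g" "ds = [] \<longrightarrow> t = 0"
    and t: "real t \<le> (real (degree F) - real n + 1) * real s * check_weight \<delta> (degree F)
      + (real (degree F) - real n) * update_weight \<delta> (degree F)"
    using algorithm_B_correct[OF f_nonzero F(1) F_sub F_two_sided generator_degrees]
    unfolding n_eq s_eq by blast
  have "is_bound \<sigma> f g"
    using g F(2) generators_two_sided[OF generators] by (intro is_boundI) auto
  moreover have "real t \<le> implied_constant \<delta> *
        (sqrt (real r) * real s * real n * I \<mu>
         + real r * sqrt (real r) * real n ^ 3 * S \<mu>
         + real s * real r * real n ^ 2 * (M \<mu> + A \<mu>))"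
    if n: "n \<ge> 1" and cheap: "S \<mu> \<le> M \<mu> \<or> real s \<le> sqrt (real r) * real n"
  proof (cases "ds = []")
    \<comment> \<open>\<open>total_cost_bound\<close> needs s >= 1; without generators the loop body
      never runs.\<close>
    case True
    then show ?thesis using g(6) bounds_nonneg by (simp add: implied_constant_def)
  next
    case False
    define N where "N = sqrt (real r) * real n"
    have "degree F \<le> degree u"
      using u F degree_left_principal by simp
    then have "real (degree F) \<le> N" using u(3) by (simp add: N_def)
    moreover have "n \<le> degree F"
      using F_sub left_principal_self[of F] degree_left_principal F(1) n_eq by blast
    moreover have "1 \<le> real s" using False s_eq by (simp add: Suc_le_eq)
    ultimately have "real t \<le> 10000 * (real \<delta> + 1) ^ 4 *
        (real s * N * I \<mu> + N ^ 3 * S \<mu> + real s * N\<^sup>2 * (M \<mu> + A \<mu>))"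
      using t bounds_nonneg cheap n
      unfolding check_weight_def update_weight_def \<tau>_def N_def[symmetric]
      by (intro total_cost_bound[where n = "real n" and d = "real (degree F)"])
        (auto simp: add.assoc)
    moreover have "N\<^sup>2 = real r * real n ^ 2" "N ^ 3 = real r * sqrt (real r) * real n ^ 3"
      by (simp_all add: N_def power_mult_distrib power3_eq_cube)
    ultimately show ?thesis by (simp add: implied_constant_def N_def mult_ac)
  qed
  ultimately show ?thesis using g(1) by blast
qed

end
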